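(* For $-1<\rho<1$, let $\gamma$ be the standard Gaussian measure, let $M_\rho\colon L^2([0,\infty),\gamma)\to L^2([0,\infty),\gamma)$ be the integral operator $$M_\rho f(x)=\int_0^\infty f(y)\,m_\rho(x,y)\,\mathrm{d}\gamma(y),\qquad m_\rho(x,y)=\frac{1}{\sqrt{1-\rho^2}}\exp\left(-\frac{\rho^2x^2+\rho^2y^2-2\rho xy}{2(1-\rho^2)}\right),$$ and let $\lambda_\rho$ be the largest eigenvalue of $M_\rho$. Then there exist a number $r_0\ge\frac13$ and real coefficients $(K_n)_{n\ge0}$ such that $$\lambda_\rho=\sum_{n=0}^\infty K_n\rho^n\qquad\text{for all }\rho\in(-r_0,r_0),$$ where the series converges for these $\rho$.
   Context: $\gamma$ denotes the standard Gaussian measure on $\mathbb{R}$, $\mathrm{d}\gamma(x)=\frac{1}{\sqrt{2\pi}}e^{-x^2/2}\,\mathrm{d}x$, and $L^2([0,\infty),\gamma)$ is taken with respect to its restriction to $[0,\infty)$. The operator $M_\rho$ is a well-defined, self-adjoint, compact (Hilbert-Schmidt) operator, so its largest eigenvalue makes sense. The number $\lambda_\rho\in(0,1)$ is the exponential decay rate of the persistence probabilities $\mathbb{P}(X_0\ge0,\dots,X_N\ge0)$ of the AR(1)-process $X_n=\rho X_{n-1}+\xi_n$, where $X_0,\xi_1,\xi_2,\dots$ are i.i.d. standard normal. *)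

theory Defs
  imports "HOL-Probability.Probability"
begin

definition gaussian :: "real measure" where
  "gaussian = density lborel (\<lambda>x. ennreal (std_normal_density x))"

definition half_gaussian :: "real measure" where
  "half_gaussian = restrict_space gaussian {0..}"

text \<open>
  Elements of a real \<open>L\<^sup>2\<close> space are represented by square-integrable functions. They are not
  quotiented by equality almost everywhere; instead, equations between them hold almost everywhere.
\<close>

definition L2 :: "'a measure \<Rightarrow> ('a \<Rightarrow> real) set" where
  "L2 M = {f \<in> borel_measurable M. integrable M (\<lambda>x. (f x)\<^sup>2)}"

definition is_L2_eigenvalue ::
    "'a measure \<Rightarrow> (('a \<Rightarrow> real) \<Rightarrow> 'a \<Rightarrow> real) \<Rightarrow> real \<Rightarrow> bool" where
  "is_L2_eigenvalue M T l \<longleftrightarrow>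
     (\<exists>f \<in> L2 M. \<not> (AE x in M. f x = 0) \<and> (AE x in M. T f x = l * f x))"

definition m_kernel :: "real \<Rightarrow> real \<Rightarrow> real \<Rightarrow> real" where
  "m_kernel \<rho> x y = 1 / sqrt (1 - \<rho>\<^sup>2) *
     exp (- ((\<rho>\<^sup>2 * x\<^sup>2 + \<rho>\<^sup>2 * y\<^sup>2 - 2 * \<rho> * x * y) / (2 * (1 - \<rho>\<^sup>2))))"

definition M_op :: "real \<Rightarrow> (real \<Rightarrow> real) \<Rightarrow> real \<Rightarrow> real" where
  "M_op \<rho> f x = (LINT y|half_gaussian. f y * m_kernel \<rho> x y)"

text \<open>
  The definitions of \<open>m_kernel\<close>, \<open>M_op\<close> and \<open>top_eigenvalue\<close> are meaningful only for
  \<open>-1 < \<rho> < 1\<close>.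
\<close>

definition top_eigenvalue :: "real \<Rightarrow> real" where
  "top_eigenvalue \<rho> = (GREATEST l. is_L2_eigenvalue half_gaussian (M_op \<rho>) l)"

end

theory Submission
  imports Defs "HOL-Complex_Analysis.Complex_Analysis"
begin

text \<open>
  By Mehler's formula, the operator is \<open>M\<^sub>\<rho> = (\<Sum>n. \<rho>\<^sup>n \<langle>\<cdot>, h\<^sub>n\<rangle> h\<^sub>n)\<close>, where \<open>h\<^sub>n\<close> are the
  normalised Hermite polynomials. On the half line \<open>\<parallel>h\<^sub>n\<parallel>\<^sup>2 = 1/2\<close>, so the part \<open>A\<^sub>\<rho>\<close> with \<open>n \<ge> 1\<close>
  has norm at most \<open>\<bar>\<rho>\<bar> / (2 (1 - \<bar>\<rho>\<bar>))\<close>, which is less than \<open>1/4\<close> exactly for \<open>\<bar>\<rho>\<bar> < 1/3\<close>.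
  For such complex \<open>\<rho>\<close> the cone of all vectors whose component along \<open>h\<^sub>0\<close> is at least as long as
  the orthogonal component is invariant under \<open>M\<^sub>\<rho>\<close>. Hence the power iteration started at \<open>h\<^sub>0\<close> and
  normalised by its \<open>h\<^sub>0\<close>-component stays bounded and is holomorphic in \<open>\<rho>\<close>. Its consecutive
  differences vanish at \<open>\<rho> = 0\<close> to increasing order, so by the Schwarz lemma they decay like
  \<open>(3 \<bar>\<rho>\<bar>)\<^sup>k\<close>. The limit is an eigenvector whose eigenvalue is holomorphic on the disc of radius
  \<open>1/3\<close>. For real \<open>\<rho>\<close>, self-adjointness and the norm bound on \<open>A\<^sub>\<rho>\<close> exclude any larger eigenvalue.
\<close>

section \<open>Holomorphic families of rank-one series\<close>

text \<open>
  The complexification of a real inner product space is modelled on pairs, with the first component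
  as real part.
\<close>

definition cinner :: "'a::real_inner \<times> 'a \<Rightarrow> 'a \<Rightarrow> complex" where
  "cinner z k = Complex (inner (fst z) k) (inner (snd z) k)"

definition cscale :: "complex \<Rightarrow> 'a::real_vector \<times> 'a \<Rightarrow> 'a \<times> 'a" where
  "cscale c z = (Re c *\<^sub>R fst z - Im c *\<^sub>R snd z, Im c *\<^sub>R fst z + Re c *\<^sub>R snd z)"

lemma cinner_add: "cinner (w + z) k = cinner w k + cinner z k"
  by (simp add: cinner_def complex_eq_iff inner_add_left)

lemma cinner_diff: "cinner (w - z) k = cinner w k - cinner z k"
  by (simp add: cinner_def complex_eq_iff inner_diff_left)

lemma cinner_cscale: "cinner (cscale c z) k = c * cinner z k"
  by (simp add: cinner_def cscale_def complex_eq_iff inner_add_left inner_diff_left algebra_simps)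

lemma cinner_real [simp]: "cinner (f, 0) k = of_real (inner f k)"
  by (simp add: cinner_def complex_eq_iff)

lemma norm_prod_sq: "(norm (z :: 'a::real_inner \<times> 'a))\<^sup>2 = (norm (fst z))\<^sup>2 + (norm (snd z))\<^sup>2"
  by (simp add: norm_prod_def)

lemma norm_cscale: "norm (cscale c (z :: 'a::real_inner \<times> 'a)) = cmod c * norm z"
proof -
  have "(norm (cscale c z))\<^sup>2 = ((Re c)\<^sup>2 + (Im c)\<^sup>2) * (norm z)\<^sup>2"
    unfolding norm_prod_sq cscale_def power2_norm_eq_inner
    by (simp add: inner_add_left inner_diff_left inner_add_right inner_diff_right
        inner_commute[of "snd z" "fst z"] algebra_simps power2_eq_square)
  also have "\<dots> = (cmod c * norm z)\<^sup>2"
    by (simp add: cmod_power2 power_mult_distrib)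
  finally show ?thesis
    by (simp add: power2_eq_iff_nonneg)
qed

lemma cscale_diff: "cscale c (w - z) = cscale c w - cscale c z"
  by (simp add: cscale_def prod_eq_iff algebra_simps)

lemma cscale_diff_left: "cscale (c - d) z = cscale c z - cscale d z"
  by (simp add: cscale_def prod_eq_iff algebra_simps)

lemma cscale_cscale: "cscale c (cscale d z) = cscale (c * d) z"
  by (simp add: cscale_def prod_eq_iff algebra_simps)

lemma cscale_one [simp]: "cscale 1 z = z"
  by (simp add: cscale_def prod_eq_iff)

lemma cscale_of_real: "cscale (of_real t) z = t *\<^sub>R z"
  by (simp add: cscale_def prod_eq_iff)

lemma norm_real_pair [simp]: "norm (f, 0 :: 'b::real_normed_vector) = norm f"
  by (simp add: norm_prod_def)

text \<open>The product space carries the real part of the Hermitian inner product of the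
  complexification. This identity carries real facts, such as Cauchy-Schwarz and the expansion of a
  squared norm, over to \<open>cinner\<close>.\<close>

lemma inner_cscale_real: "inner (cscale c (k, 0)) z = Re (cnj c * cinner z k)"
  by (simp add: cscale_def cinner_def inner_prod_def inner_commute algebra_simps)

text \<open>Multiplying \<open>k\<close> by the scalar \<open>c = cinner z k\<close> makes the real
  pairing equal to the full square of \<open>cmod c\<close>, so the real Cauchy-Schwarz inequality
  loses nothing.\<close>

lemma norm_cinner_le: "cmod (cinner z k) \<le> norm z * norm k"
proof -
  define c where "c = cinner z k"
  have "(cmod c)\<^sup>2 = inner (cscale c (k, 0)) z"
    unfolding inner_cscale_real c_def[symmetric] cmod_power2
    by (simp flip: power2_eq_square)
  also have "\<dots> \<le> norm (cscale c (k, 0)) * norm z"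
    by (rule norm_cauchy_schwarz)
  also have "\<dots> = cmod c * (norm z * norm k)"
    by (simp add: norm_cscale)
  finally have "cmod c * cmod c \<le> cmod c * (norm z * norm k)"
    by (simp add: power2_eq_square)
  then show ?thesis
    by (cases "cmod c = 0") (auto simp: c_def)
qed

lemma bounded_linear_cinner: "bounded_linear (\<lambda>z. cinner z k)"
proof (rule bounded_linear_intro)
  show "cinner (r *\<^sub>R x) k = r *\<^sub>R cinner x k" for r x
    by (simp add: cscale_of_real[symmetric] cinner_cscale scaleR_conv_of_real)
qed (rule cinner_add norm_cinner_le)+

section \<open>Zeros of higher order and the Schwarz lemma\<close>

text \<open>Each induction step divides out one zero at the origin. The bound with \<open>C\<close>
  forces a zero of order \<open>k\<close>; its size is lost, so a crude \<open>C\<close> can be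
  traded for the bound \<open>B\<close> on the whole disc.\<close>

lemma holomorphic_order_bound:
  fixes f :: "complex \<Rightarrow> complex"
  assumes "f holomorphic_on ball 0 r" "\<And>z. cmod z < r \<Longrightarrow> cmod (f z) \<le> B"
    and "\<And>z. cmod z < r \<Longrightarrow> cmod (f z) \<le> C * cmod z ^ k" and "cmod z < r"
  shows "cmod (f z) \<le> B * (cmod z / r) ^ k"
  using assms
proof (induction k arbitrary: f z B)
  case 0
  then show ?case by simp
next
  case (Suc k)
  have r: "r > 0" using Suc.prems(4) norm_ge_zero[of z] by linarith
  have B: "B \<ge> 0" using order_trans[OF norm_ge_zero Suc.prems(2)[of 0]] r by simp
  have f0: "f 0 = 0" using Suc.prems(3)[of 0] r by simp
  obtain g where g: "g holomorphic_on ball 0 r" "\<And>z. cmod z < r \<Longrightarrow> f z = z * g z"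
    using Schwarz3[OF Suc.prems(1) f0] by blast
  have gC: "cmod (g z) \<le> C * cmod z ^ k" if "cmod z < r" "z \<noteq> 0" for z
  proof -
    have "cmod z * cmod (g z) \<le> cmod z * (C * cmod z ^ k)"
      using Suc.prems(3)[OF that(1)] g(2)[OF that(1)] by (simp add: norm_mult mult_ac)
    then show ?thesis using that by simp
  qed
  have cont: "isCont g 0"
    using holomorphic_on_imp_continuous_on[OF g(1)] r by (simp add: continuous_on_eq_continuous_at)
  \<comment> \<open>Division by \<open>z\<close> gives the bound away from the origin; at the origin
    it follows by continuity.\<close>
  have gC': "cmod (g z) \<le> C * cmod z ^ k" if "cmod z < r" for z
  proof (cases "z = 0")
    case True
    have "((\<lambda>z. C * cmod z ^ k - cmod (g z)) \<longlongrightarrow> C * cmod 0 ^ k - cmod (g 0)) (at 0)"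
      by (intro tendsto_intros isContD[OF cont])
    moreover have "eventually (\<lambda>z. 0 \<le> C * cmod z ^ k - cmod (g z)) (at 0)"
      unfolding eventually_at using r gC by (auto simp: dist_norm)
    ultimately have "0 \<le> C * cmod 0 ^ k - cmod (g 0)"
      by (rule tendsto_lowerbound) simp
    then show ?thesis using True by simp
  qed (use gC that in auto)
  \<comment> \<open>The maximum modulus principle on circles of radius \<open>s < r\<close> gives
    \<open>B / s\<close>. Then \<open>s\<close> tends to \<open>r\<close>, since nothing is known on
    the boundary circle itself.\<close>
  have gB: "cmod (g z) \<le> B / r" if z: "cmod z < r" for z
  proof (rule field_le_epsilon)
    fix e :: real assume e: "e > 0"
    have "((\<lambda>s. B / s) \<longlongrightarrow> B / r) (at_left r)"
      using r by (intro tendsto_intros) auto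
    then have "eventually (\<lambda>s. B / s < B / r + e) (at_left r)"
      by (rule order_tendstoD) (use e in auto)
    moreover have "eventually (\<lambda>s. cmod z < s \<and> s < r) (at_left r)"
      using eventually_at_left_real[OF z] by simp
    ultimately have "eventually (\<lambda>s. B / s < B / r + e \<and> cmod z < s \<and> s < r) (at_left r)"
      by eventually_elim auto
    then obtain s where s: "B / s < B / r + e" "cmod z < s" "s < r"
      using eventually_happens'[OF trivial_limit_at_left_real] by blast
    have "0 < s" using s(2) norm_ge_zero[of z] by linarith
    note s = s(1,2) this s(3)
    have "cmod (g z) \<le> B / s"
    proof (rule maximum_modulus_frontier[of g "cball 0 s"])
      show "g holomorphic_on interior (cball 0 s)" "continuous_on (closure (cball 0 s)) g"
        using g(1) s by (auto intro!: holomorphic_on_imp_continuous_on intro: holomorphic_on_subset)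
      fix w :: complex assume "w \<in> frontier (cball 0 s)"
      then have w: "cmod w = s" using s by (simp add: frontier_cball)
      then have "s * cmod (g w) \<le> B" using Suc.prems(2)[of w] g(2)[of w] s by (simp add: norm_mult)
      then show "cmod (g w) \<le> B / s" using s by (simp add: field_simps)
    qed (use s in auto)
    then show "cmod (g z) \<le> B / r + e" using s by simp
  qed
  have "cmod (g z) \<le> B / r * (cmod z / r) ^ k"
    by (rule Suc.IH[OF g(1) gB gC' Suc.prems(4)])
  then have "cmod z * cmod (g z) \<le> cmod z * (B / r * (cmod z / r) ^ k)"
    by (rule mult_left_mono) simp
  also have "cmod z * cmod (g z) = cmod (f z)"
    using g(2)[OF Suc.prems(4)] by (simp add: norm_mult)
  also have "cmod z * (B / r * (cmod z / r) ^ k) = B * (cmod z / r) ^ Suc k"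
    by simp
  finally show ?case .
qed


section \<open>The rank-one series, its perturbation part and the invariant cone\<close>

text \<open>No orthogonality is assumed: on the half line the Hermite polynomials are not
  orthogonal, and only their common length enters.\<close>

locale rank_one_series =
  fixes h :: "nat \<Rightarrow> 'a::{real_inner, banach}"
  assumes inner_h_self: "inner (h n) (h n) = 1 / 2"
begin

definition Mop :: "complex \<Rightarrow> 'a \<times> 'a \<Rightarrow> 'a \<times> 'a" where
  "Mop \<rho> z = (\<Sum>n. cscale (\<rho> ^ n * cinner z (h n)) (h n, 0))"

definition Aop :: "complex \<Rightarrow> 'a \<times> 'a \<Rightarrow> 'a \<times> 'a" where
  "Aop \<rho> z = (\<Sum>n. cscale (\<rho> ^ Suc n * cinner z (h (Suc n))) (h (Suc n), 0))"

definition Mreal :: "real \<Rightarrow> 'a \<Rightarrow> 'a" where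
  "Mreal t f = (\<Sum>n. (t ^ n * inner f (h n)) *\<^sub>R h n)"

lemma norm_h_sq: "(norm (h n))\<^sup>2 = 1 / 2"
  by (simp add: power2_norm_eq_inner inner_h_self)

lemma norm_h_le_1: "norm (h n) \<le> 1"
proof (rule power2_le_imp_le)
  show "(norm (h n))\<^sup>2 \<le> 1\<^sup>2" by (simp add: norm_h_sq)
qed simp

text \<open>The factor 1/2 is the squared norm of \<open>h n\<close>: one factor comes from
  Cauchy-Schwarz and one from the vector itself.\<close>

lemma norm_term_le:
  "norm (cscale (\<rho> ^ n * cinner z (h n)) (h n, 0)) \<le> norm z / 2 * cmod \<rho> ^ n"
proof -
  have "cmod (cinner z (h n)) * norm (h n) \<le> (norm z * norm (h n)) * norm (h n)"
    by (rule mult_right_mono[OF norm_cinner_le]) simp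
  also have "\<dots> = norm z / 2"
    using norm_h_sq[of n] by (simp add: power2_eq_square mult.assoc)
  finally have "cmod \<rho> ^ n * (cmod (cinner z (h n)) * norm (h n)) \<le> cmod \<rho> ^ n * (norm z / 2)"
    by (rule mult_left_mono) simp
  then show ?thesis
    by (simp add: norm_cscale norm_mult norm_power mult_ac)
qed

lemma summable_norm_term:
  assumes "cmod \<rho> < 1"
  shows "summable (\<lambda>n. norm (cscale (\<rho> ^ n * cinner z (h n)) (h n, 0)))"
proof (rule summable_comparison_test')
  show "summable (\<lambda>n. norm z / 2 * cmod \<rho> ^ n)"
    using assms by (intro summable_mult summable_geometric) simp
  show "norm (norm (cscale (\<rho> ^ n * cinner z (h n)) (h n, 0))) \<le> norm z / 2 * cmod \<rho> ^ n" for n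
    using norm_term_le by simp
qed

lemma summable_term:
  "cmod \<rho> < 1 \<Longrightarrow> summable (\<lambda>n. cscale (\<rho> ^ n * cinner z (h n)) (h n, 0))"
  by (rule summable_norm_cancel[OF summable_norm_term])

lemma Mop_eq:
  assumes "cmod \<rho> < 1"
  shows "Mop \<rho> z = cscale (cinner z (h 0)) (h 0, 0) + Aop \<rho> z"
  unfolding Mop_def Aop_def using suminf_split_head[OF summable_term[OF assms], of z] by simp

text \<open>The geometric series gives \<open>cmod \<rho> / (2 * (1 - cmod \<rho>))\<close>, and the
  denominator exceeds 4/3. The factor \<open>cmod \<rho>\<close> is kept because it makes the
  differences of the iteration vanish at the origin.\<close>

lemma norm_Aop:
  assumes \<rho>: "cmod \<rho> < 1 / 3"
  shows "norm (Aop \<rho> z) \<le> 3 / 4 * cmod \<rho> * norm z"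
proof -
  have "norm (Aop \<rho> z) \<le> (\<Sum>n. norm z / 2 * cmod \<rho> ^ Suc n)"
    unfolding Aop_def
  proof (rule norm_suminf_le[OF norm_term_le])
    show "summable (\<lambda>n. norm z / 2 * cmod \<rho> ^ Suc n)"
      using \<rho> by (intro summable_mult summable_Suc_iff[THEN iffD2] summable_geometric) simp
  qed
  also have "\<dots> = norm z / 2 * cmod \<rho> * (\<Sum>n. cmod \<rho> ^ n)"
    using \<rho> by (subst suminf_mult[symmetric]) (auto intro!: summable_geometric simp: mult_ac)
  also have "\<dots> = norm z / 2 * cmod \<rho> * (1 / (1 - cmod \<rho>))"
    using \<rho> by (subst suminf_geometric) auto
  also have "\<dots> \<le> norm z / 2 * cmod \<rho> * (3 / 2)"
    using \<rho> by (intro mult_left_mono) (auto simp: field_simps)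
  finally show ?thesis by (simp add: mult_ac)
qed

lemma Aop_diff:
  assumes "cmod \<rho> < 1"
  shows "Aop \<rho> (w - z) = Aop \<rho> w - Aop \<rho> z"
proof -
  have *: "summable (\<lambda>n. cscale (\<rho> ^ Suc n * cinner z (h (Suc n))) (h (Suc n), 0))" for z
    using summable_term[OF assms, of z] by (subst summable_Suc_iff)
  show ?thesis
    unfolding Aop_def suminf_diff[OF * *] by (simp add: cinner_diff right_diff_distrib cscale_diff_left)
qed

text \<open>Let \<open>c = cinner z (h 0)\<close>. As \<open>h 0\<close> has squared norm 1/2, the
  component of \<open>z\<close> along it has squared norm \<open>2 * (cmod c)\<^sup>2\<close>; so
  \<open>norm z \<le> 2 * cmod c\<close> says that this component is at least as long as the
  orthogonal one. The other two bounds control the divisor in the normalised iteration.\<close>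

lemma cone_step:
  assumes \<rho>: "cmod \<rho> < 1 / 3" and p: "norm z \<le> 2 * cmod (cinner z (h 0))"
  shows "norm (Mop \<rho> z) \<le> 2 * cmod (cinner (Mop \<rho> z) (h 0))"
    and "cmod (cinner z (h 0)) / 8 \<le> cmod (cinner (Mop \<rho> z) (h 0))"
    and "cmod (cinner (Mop \<rho> z) (h 0)) \<le> cmod (cinner z (h 0))"
proof -
  define c where "c = cinner z (h 0)"
  define q where "q = cinner (Aop \<rho> z) (h 0)"
  have "norm (Aop \<rho> z) \<le> 3 / 4 * cmod \<rho> * norm z" by (rule norm_Aop[OF \<rho>])
  also have "\<dots> \<le> 3 / 4 * (1 / 3) * (2 * cmod c)"
    using \<rho> p by (intro mult_mono) (auto simp: c_def)
  finally have A: "norm (Aop \<rho> z) \<le> cmod c / 2" by simp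
  then have A2: "(norm (Aop \<rho> z))\<^sup>2 \<le> (cmod c)\<^sup>2 / 4"
    using power_mono[OF A norm_ge_zero, of 2] by (simp add: power_divide)
  \<comment> \<open>The argument bounds \<open>cmod q\<close> by \<open>cmod c / sqrt 8\<close>, and
    3/8 is a rational number above this constant. The remaining margins are 1/2 - 3/8 = 1/8 and 1/2
    + 3/8 < 1.\<close>
  have "(cmod q)\<^sup>2 \<le> (norm (Aop \<rho> z) * norm (h 0))\<^sup>2"
    unfolding q_def by (intro power_mono norm_cinner_le) simp
  also have "\<dots> = (norm (Aop \<rho> z))\<^sup>2 / 2" by (simp add: power_mult_distrib norm_h_sq)
  finally have "64 * (cmod q)\<^sup>2 \<le> 9 * (cmod c)\<^sup>2"
    using A2 zero_le_power2[of "cmod c"] by linarith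
  then have "(cmod q)\<^sup>2 \<le> (3 / 8 * cmod c)\<^sup>2"
    by (simp add: power_mult_distrib power_divide)
  then have q: "cmod q \<le> 3 / 8 * cmod c"
    by (rule power2_le_imp_le) simp
  have M: "Mop \<rho> z = cscale c (h 0, 0) + Aop \<rho> z"
    unfolding c_def using \<rho> by (intro Mop_eq) simp
  have p': "cinner (Mop \<rho> z) (h 0) = c / 2 + q"
    by (simp add: M cinner_add cinner_cscale inner_h_self q_def)
  have "cmod (c / 2) - cmod q \<le> cmod (c / 2 + q)" "cmod (c / 2 + q) \<le> cmod (c / 2) + cmod q"
    by (rule norm_diff_ineq norm_triangle_ineq)+
  then show "cmod (cinner z (h 0)) / 8 \<le> cmod (cinner (Mop \<rho> z) (h 0))"
    and "cmod (cinner (Mop \<rho> z) (h 0)) \<le> cmod (cinner z (h 0))"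
    using q unfolding p' c_def[symmetric] by (simp_all add: norm_divide)
  \<comment> \<open>The defect of the cone condition is bounded below by a perfect square.\<close>
  have "(norm (Mop \<rho> z))\<^sup>2 = (cmod c)\<^sup>2 / 2 + 2 * Re (cnj c * q) + (norm (Aop \<rho> z))\<^sup>2"
  proof -
    have "(norm (X + Y))\<^sup>2 = (norm X)\<^sup>2 + 2 * inner X Y + (norm Y)\<^sup>2" for X Y :: "'a \<times> 'a"
      by (simp add: power2_norm_eq_inner inner_add_left inner_add_right inner_commute)
    then show ?thesis
      unfolding M by (simp add: inner_cscale_real q_def norm_cscale power_mult_distrib norm_h_sq)
  qed
  also have "\<dots> \<le> 3 / 4 * (cmod c)\<^sup>2 + 2 * Re (cnj c * q) + (cmod (c / 2 + 2 * q))\<^sup>2"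
    using A2 zero_le_power2[of "cmod (c / 2 + 2 * q)"] by linarith
  also have "\<dots> = (2 * cmod (c / 2 + q))\<^sup>2"
    unfolding power_mult_distrib cmod_power2 by (simp add: field_simps power2_eq_square)
  finally show "norm (Mop \<rho> z) \<le> 2 * cmod (cinner (Mop \<rho> z) (h 0))"
    unfolding p' by (rule power2_le_imp_le) simp
qed

section \<open>Normalised power iteration\<close>

text \<open>Starting at twice \<open>h 0\<close> makes the pairing with \<open>h 0\<close> equal to
  1, and dividing by that pairing keeps it so. Normalising by a linear functional, unlike
  normalising by the norm, preserves holomorphy in \<rho>.\<close>

primrec iter :: "complex \<Rightarrow> nat \<Rightarrow> 'a \<times> 'a" where
  "iter \<rho> 0 = (2 *\<^sub>R h 0, 0)"
| "iter \<rho> (Suc k) = cscale (1 / cinner (Mop \<rho> (iter \<rho> k)) (h 0)) (Mop \<rho> (iter \<rho> k))"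

text \<open>At an eigenvector whose pairing with \<open>h 0\<close> is 1, the corresponding number
  is the eigenvalue.\<close>

definition ratio :: "complex \<Rightarrow> nat \<Rightarrow> complex" where
  "ratio \<rho> k = cinner (Mop \<rho> (iter \<rho> k)) (h 0)"

lemma iter_normalised:
  assumes \<rho>: "cmod \<rho> < 1 / 3"
  shows "cinner (iter \<rho> k) (h 0) = 1" and "norm (iter \<rho> k) \<le> 2"
proof (induction k)
  case 0
  show "cinner (iter \<rho> 0) (h 0) = 1" by (simp add: inner_h_self)
  show "norm (iter \<rho> 0) \<le> 2" using norm_h_le_1[of 0] by simp
next
  case (Suc k)
  have c: "norm (iter \<rho> k) \<le> 2 * cmod (cinner (iter \<rho> k) (h 0))" using Suc by simp
  note cone = cone_step[OF \<rho> c]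
  have nz: "cinner (Mop \<rho> (iter \<rho> k)) (h 0) \<noteq> 0" using cone(2) Suc by auto
  then show "cinner (iter \<rho> (Suc k)) (h 0) = 1" by (simp add: cinner_cscale)
  show "norm (iter \<rho> (Suc k)) \<le> 2"
    using cone(1) nz by (simp add: norm_cscale norm_divide divide_simps)
qed

lemma ratio_bounds:
  assumes \<rho>: "cmod \<rho> < 1 / 3"
  shows "1 / 8 \<le> cmod (ratio \<rho> k)" "cmod (ratio \<rho> k) \<le> 1" "ratio \<rho> k \<noteq> 0"
proof -
  have c: "norm (iter \<rho> k) \<le> 2 * cmod (cinner (iter \<rho> k) (h 0))"
    using iter_normalised[OF \<rho>] by simp
  show "1 / 8 \<le> cmod (ratio \<rho> k)" "cmod (ratio \<rho> k) \<le> 1"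
    using cone_step[OF \<rho> c] iter_normalised[OF \<rho>] by (simp_all add: ratio_def)
  then show "ratio \<rho> k \<noteq> 0" by auto
qed

lemma cscale_ratio_iter: "cmod \<rho> < 1 / 3 \<Longrightarrow> cscale (ratio \<rho> k) (iter \<rho> (Suc k)) = Mop \<rho> (iter \<rho> k)"
  using ratio_bounds(3)[of \<rho> k] by (simp add: cscale_cscale ratio_def)

text \<open>Both iterates have pairing 1 with \<open>h 0\<close>, so the rank-one terms cancel and
  only the perturbation remains.\<close>

lemma Mop_iter_diff:
  assumes \<rho>: "cmod \<rho> < 1 / 3"
  shows "Mop \<rho> (iter \<rho> (Suc k)) - Mop \<rho> (iter \<rho> k) = Aop \<rho> (iter \<rho> (Suc k) - iter \<rho> k)"
proof -
  have \<rho>1: "cmod \<rho> < 1" using \<rho> by simp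
  show ?thesis
    unfolding Mop_eq[OF \<rho>1] Aop_diff[OF \<rho>1] using iter_normalised(1)[OF \<rho>, of "Suc k"] iter_normalised(1)[OF \<rho>, of k]
    by (simp del: iter.simps)
qed

lemma ratio_diff:
  assumes \<rho>: "cmod \<rho> < 1 / 3"
  shows "ratio \<rho> (Suc k) - ratio \<rho> k = cinner (Aop \<rho> (iter \<rho> (Suc k) - iter \<rho> k)) (h 0)"
  unfolding ratio_def Mop_iter_diff[OF \<rho>, symmetric] cinner_diff ..

text \<open>The constant is 8 * 3 * 3/4: the 8 from the lower bound on \<open>ratio\<close>, the 3
  from the change of the vector plus the change of the ratio times an iterate of norm at most 2, and
  the 3/4 from \<open>norm_Aop\<close>.\<close>

lemma norm_iter_diff_Suc:
  assumes \<rho>: "cmod \<rho> < 1 / 3"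
  shows "norm (iter \<rho> (Suc (Suc k)) - iter \<rho> (Suc k)) \<le> 18 * cmod \<rho> * norm (iter \<rho> (Suc k) - iter \<rho> k)"
proof -
  define d where "d = iter \<rho> (Suc k) - iter \<rho> k"
  define w where "w = iter \<rho> (Suc k)"
  have "cscale (ratio \<rho> (Suc k)) (iter \<rho> (Suc (Suc k)) - w) = Mop \<rho> w - cscale (ratio \<rho> (Suc k)) w"
    unfolding cscale_diff w_def cscale_ratio_iter[OF \<rho>] ..
  also have "\<dots> = (Mop \<rho> w - Mop \<rho> (iter \<rho> k)) - cscale (ratio \<rho> (Suc k) - ratio \<rho> k) w"
    unfolding cscale_diff_left cscale_ratio_iter[OF \<rho>, symmetric] w_def by (simp del: iter.simps)
  also have "\<dots> = Aop \<rho> d - cscale (cinner (Aop \<rho> d) (h 0)) w"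
    unfolding w_def d_def Mop_iter_diff[OF \<rho>] ratio_diff[OF \<rho>] ..
  finally have eq: "cscale (ratio \<rho> (Suc k)) (iter \<rho> (Suc (Suc k)) - w) = \<dots>" .
  have "cmod (cinner (Aop \<rho> d) (h 0)) \<le> norm (Aop \<rho> d) * 1"
    by (rule order_trans[OF norm_cinner_le]) (intro mult_left_mono norm_h_le_1 norm_ge_zero)
  then have "norm (cscale (cinner (Aop \<rho> d) (h 0)) w) \<le> (norm (Aop \<rho> d) * 1) * 2"
    unfolding norm_cscale w_def using iter_normalised(2)[OF \<rho>] by (intro mult_mono) (auto simp del: iter.simps)
  then have "cmod (ratio \<rho> (Suc k)) * norm (iter \<rho> (Suc (Suc k)) - w) \<le> 3 * norm (Aop \<rho> d)"
    unfolding norm_cscale[symmetric] eq using norm_triangle_ineq4[of "Aop \<rho> d" "cscale (cinner (Aop \<rho> d) (h 0)) w"] by simp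
  moreover have "1 / 8 * norm (iter \<rho> (Suc (Suc k)) - w) \<le> cmod (ratio \<rho> (Suc k)) * norm (iter \<rho> (Suc (Suc k)) - w)"
    by (rule mult_right_mono[OF ratio_bounds(1)[OF \<rho>]]) simp
  ultimately show ?thesis
    using norm_Aop[OF \<rho>, of d] unfolding d_def[symmetric] w_def by linarith
qed

text \<open>As a rate of decay this helps only for \<open>cmod \<rho> < 1 / 18\<close>. Its purpose
  is the zero of order \<open>k\<close> at the origin that \<open>holomorphic_order_bound\<close>
  asks for.\<close>

lemma norm_iter_diff:
  assumes \<rho>: "cmod \<rho> < 1 / 3"
  shows "norm (iter \<rho> (Suc k) - iter \<rho> k) \<le> 4 * (18 * cmod \<rho>) ^ k"
proof (induction k)
  case 0
  show ?case
    using norm_triangle_ineq4[of "iter \<rho> (Suc 0)" "iter \<rho> 0"] iter_normalised(2)[OF \<rho>, of 0]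
      iter_normalised(2)[OF \<rho>, of "Suc 0"] by (simp del: iter.simps)
next
  case (Suc k)
  have "norm (iter \<rho> (Suc (Suc k)) - iter \<rho> (Suc k)) \<le> 18 * cmod \<rho> * (4 * (18 * cmod \<rho>) ^ k)"
    by (rule order_trans[OF norm_iter_diff_Suc[OF \<rho>] mult_left_mono[OF Suc]]) simp
  also have "\<dots> = 4 * (18 * cmod \<rho>) ^ Suc k" by simp
  finally show ?case .
qed

section \<open>Holomorphy of the iterates and their geometric rate\<close>

lemma cinner_Mop_sums:
  assumes "cmod \<rho> < 1"
  shows "(\<lambda>n. \<rho> ^ n * cinner z (h n) * of_real (inner (h n) g)) sums cinner (Mop \<rho> z) g"
proof -
  have "(\<lambda>n. cinner (cscale (\<rho> ^ n * cinner z (h n)) (h n, 0)) g) sums cinner (Mop \<rho> z) g"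
    unfolding Mop_def
    by (rule bounded_linear.sums[OF bounded_linear_cinner summable_sums[OF summable_term[OF assms]]])
  then show ?thesis by (simp add: cinner_cscale)
qed

text \<open>Holomorphy of vector-valued maps is expressed weakly, through pairings with fixed real
  vectors. The series of \<open>Mop\<close> pairs \<open>w\<close> with the \<open>h n\<close> only,
  and its terms are dominated by a geometric series of ratio 1/3, so the sum is a locally uniform
  limit.\<close>

lemma holomorphic_cinner_Mop:
  assumes hol: "\<And>g. (\<lambda>\<rho>. cinner (w \<rho>) g) holomorphic_on ball 0 (1 / 3)"
    and bd: "\<And>\<rho>. cmod \<rho> < 1 / 3 \<Longrightarrow> norm (w \<rho>) \<le> 2"
  shows "(\<lambda>\<rho>. cinner (Mop \<rho> (w \<rho>)) g) holomorphic_on ball 0 (1 / 3)"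
proof (rule holomorphic_uniform_sequence)
  let ?f = "\<lambda>n \<rho>. \<rho> ^ n * cinner (w \<rho>) (h n) * of_real (inner (h n) g)"
  show "(\<lambda>\<rho>. \<Sum>n<N. ?f n \<rho>) holomorphic_on ball 0 (1 / 3)" for N
    by (intro holomorphic_intros hol)
  have bound: "norm (?f n \<rho>) \<le> (1 / 3) ^ n * (2 * norm g)" if "cmod \<rho> < 1 / 3" for n \<rho>
  proof -
    have 1: "cmod (cinner (w \<rho>) (h n)) \<le> 2 * 1"
      by (rule order_trans[OF norm_cinner_le]) (intro mult_mono bd that norm_h_le_1, auto)
    have 2: "\<bar>inner (h n) g\<bar> \<le> 1 * norm g"
      by (rule order_trans[OF Cauchy_Schwarz_ineq2]) (intro mult_right_mono norm_h_le_1 norm_ge_zero)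
    have "norm (?f n \<rho>) = cmod \<rho> ^ n * (cmod (cinner (w \<rho>) (h n)) * \<bar>inner (h n) g\<bar>)"
      by (simp add: norm_mult norm_power)
    also have "\<dots> \<le> (1 / 3) ^ n * ((2 * 1) * (1 * norm g))"
      using that by (intro mult_mono power_mono 1 2) auto
    finally show ?thesis by simp
  qed
  fix x :: complex assume "x \<in> ball 0 (1 / 3)"
  then obtain d where d: "0 < d" "cball x d \<subseteq> ball 0 (1 / 3)"
    using open_contains_cball open_ball by blast
  have "uniform_limit (cball x d) (\<lambda>N \<rho>. \<Sum>n<N. ?f n \<rho>) (\<lambda>\<rho>. \<Sum>n. ?f n \<rho>) sequentially"
  proof (rule Weierstrass_m_test)
    show "summable (\<lambda>n. (1 / 3 :: real) ^ n * (2 * norm g))"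
      by (intro summable_mult2 summable_geometric) simp
  qed (use d bound in \<open>auto simp: subset_iff\<close>)
  also have "?this \<longleftrightarrow> uniform_limit (cball x d) (\<lambda>N \<rho>. \<Sum>n<N. ?f n \<rho>) (\<lambda>\<rho>. cinner (Mop \<rho> (w \<rho>)) g) sequentially"
  proof (intro uniform_limit_cong')
    fix \<rho> assume "\<rho> \<in> cball x d"
    then have "\<rho> \<in> ball 0 (1 / 3)" using d by blast
    then show "(\<Sum>n. ?f n \<rho>) = cinner (Mop \<rho> (w \<rho>)) g"
      by (intro sums_unique[symmetric] cinner_Mop_sums) simp
  qed simp
  finally show "\<exists>d>0. cball x d \<subseteq> ball 0 (1 / 3) \<and>
      uniform_limit (cball x d) (\<lambda>N \<rho>. \<Sum>n<N. ?f n \<rho>) (\<lambda>\<rho>. cinner (Mop \<rho> (w \<rho>)) g) sequentially"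
    using d by blast
qed simp


lemma holomorphic_iter:
  "(\<lambda>\<rho>. cinner (iter \<rho> k) g) holomorphic_on ball 0 (1 / 3)"
proof (induction k arbitrary: g)
  case (Suc k)
  have hol: "(\<lambda>\<rho>. cinner (Mop \<rho> (iter \<rho> k)) g) holomorphic_on ball 0 (1 / 3)" for g
    by (rule holomorphic_cinner_Mop[OF Suc iter_normalised(2)])
  show ?case
    unfolding iter.simps cinner_cscale
    using ratio_bounds(3) by (intro holomorphic_intros hol) (auto simp: ratio_def)
qed simp

lemma holomorphic_ratio: "(\<lambda>\<rho>. ratio \<rho> k) holomorphic_on ball 0 (1 / 3)"
  unfolding ratio_def by (rule holomorphic_cinner_Mop[OF holomorphic_iter iter_normalised(2)])

text \<open>The trivial bound 4 on the disc of radius 1/3 and the zero of order \<open>k\<close>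
  from \<open>norm_iter_diff\<close> give the rate \<open>3 * cmod \<rho>\<close> for every pairing,
  by \<open>holomorphic_order_bound\<close>. Real and imaginary part cost 4 each, hence 8.\<close>

lemma norm_iter_diff_geometric:
  assumes \<rho>: "cmod \<rho> < 1 / 3"
  shows "norm (iter \<rho> (Suc k) - iter \<rho> k) \<le> 8 * (3 * cmod \<rho>) ^ k"
proof -
  define d where "d \<rho> = iter \<rho> (Suc k) - iter \<rho> k" for \<rho>
  have d4: "norm (d \<rho>) \<le> 4" if "cmod \<rho> < 1 / 3" for \<rho>
    using norm_triangle_ineq4[of "iter \<rho> (Suc k)" "iter \<rho> k"] iter_normalised(2)[OF that, of k]
      iter_normalised(2)[OF that, of "Suc k"] unfolding d_def by linarith
  have weak: "cmod (cinner (d \<rho>) g) \<le> 4 * (3 * cmod \<rho>) ^ k * norm g" for g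
  proof -
    have "cmod (cinner (d \<rho>) g) \<le> 4 * norm g * (cmod \<rho> / (1 / 3)) ^ k"
    proof (rule holomorphic_order_bound[of "\<lambda>\<rho>. cinner (d \<rho>) g", where C = "4 * 18 ^ k * norm g"])
      show "(\<lambda>\<rho>. cinner (d \<rho>) g) holomorphic_on ball 0 (1 / 3)"
        unfolding d_def cinner_diff by (intro holomorphic_intros holomorphic_iter)
      fix z :: complex assume z: "cmod z < 1 / 3"
      show "cmod (cinner (d z) g) \<le> 4 * norm g"
        by (rule order_trans[OF norm_cinner_le]) (intro mult_right_mono d4 z norm_ge_zero)
      have "cmod (cinner (d z) g) \<le> 4 * (18 * cmod z) ^ k * norm g"
        unfolding d_def
        by (rule order_trans[OF norm_cinner_le]) (intro mult_right_mono norm_iter_diff z norm_ge_zero)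
      then show "cmod (cinner (d z) g) \<le> 4 * 18 ^ k * norm g * cmod z ^ k"
        by (simp add: power_mult_distrib mult_ac)
    qed (rule \<rho>)
    then show ?thesis by (simp add: mult_ac)
  qed
  \<comment> \<open>Since \<open>weak\<close> holds for every \<open>g\<close>, the vector to be
    estimated may itself serve as \<open>g\<close>.\<close>
  have "norm (fst (d \<rho>)) * norm (fst (d \<rho>)) = Re (cinner (d \<rho>) (fst (d \<rho>)))"
    by (simp add: cinner_def power2_norm_eq_inner flip: power2_eq_square)
  also have "\<dots> \<le> 4 * (3 * cmod \<rho>) ^ k * norm (fst (d \<rho>))"
    by (rule order_trans[OF complex_Re_le_cmod weak])
  finally have 1: "norm (fst (d \<rho>)) \<le> 4 * (3 * cmod \<rho>) ^ k"
    by (cases "fst (d \<rho>) = 0") auto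
  have "norm (snd (d \<rho>)) * norm (snd (d \<rho>)) = Im (cinner (d \<rho>) (snd (d \<rho>)))"
    by (simp add: cinner_def power2_norm_eq_inner flip: power2_eq_square)
  also have "\<dots> \<le> 4 * (3 * cmod \<rho>) ^ k * norm (snd (d \<rho>))"
    by (rule order_trans[OF order_trans[OF abs_ge_self abs_Im_le_cmod] weak])
  finally have 2: "norm (snd (d \<rho>)) \<le> 4 * (3 * cmod \<rho>) ^ k"
    by (cases "snd (d \<rho>) = 0") auto
  have "norm (d \<rho>) \<le> norm (fst (d \<rho>)) + norm (snd (d \<rho>))"
    using norm_Pair_le[of "fst (d \<rho>)" "snd (d \<rho>)"] by simp
  then show ?thesis using 1 2 unfolding d_def by linarith
qed

lemma norm_ratio_diff_geometric:
  assumes \<rho>: "cmod \<rho> < 1 / 3"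
  shows "cmod (ratio \<rho> (Suc k) - ratio \<rho> k) \<le> 8 * (3 * cmod \<rho>) ^ k"
proof -
  define d where "d = iter \<rho> (Suc k) - iter \<rho> k"
  have "cmod (ratio \<rho> (Suc k) - ratio \<rho> k) \<le> norm (Aop \<rho> d) * 1"
    unfolding ratio_diff[OF \<rho>] d_def[symmetric]
    by (rule order_trans[OF norm_cinner_le]) (intro mult_left_mono norm_h_le_1 norm_ge_zero)
  also have "\<dots> \<le> 3 / 4 * cmod \<rho> * norm d" using norm_Aop[OF \<rho>] by simp
  also have "\<dots> \<le> 1 * norm d" using \<rho> by (intro mult_right_mono) auto
  also have "\<dots> \<le> 8 * (3 * cmod \<rho>) ^ k"
    unfolding d_def using norm_iter_diff_geometric[OF \<rho>] by simp
  finally show ?thesis .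
qed

section \<open>The eigenvalue as a holomorphic function\<close>

text \<open>The limit of the ratios, written as a telescoping series so that the Weierstrass test
  yields locally uniform convergence.\<close>

definition eigval :: "complex \<Rightarrow> complex" where
  "eigval \<rho> = ratio \<rho> 0 + (\<Sum>k. ratio \<rho> (Suc k) - ratio \<rho> k)"

lemma holomorphic_eigval: "eigval holomorphic_on ball 0 (1 / 3)"
proof (rule holomorphic_uniform_sequence)
  let ?d = "\<lambda>k \<rho>. ratio \<rho> (Suc k) - ratio \<rho> k"
  show "(\<lambda>\<rho>. ratio \<rho> 0 + (\<Sum>k<N. ?d k \<rho>)) holomorphic_on ball 0 (1 / 3)" for N
    by (intro holomorphic_intros holomorphic_ratio)
  fix x :: complex assume x: "x \<in> ball 0 (1 / 3)"
  \<comment> \<open>Half the distance to the boundary circle: on the closed ball the majorant is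
    geometric with ratio \<open>3 * (cmod x + e) < 1\<close>.\<close>
  define e where "e = (1 / 3 - cmod x) / 2"
  have e: "e > 0" "cmod x + e < 1 / 3" using x by (auto simp: e_def field_simps)
  have le: "cmod \<rho> \<le> cmod x + e" if "\<rho> \<in> cball x e" for \<rho>
    using that norm_triangle_sub[of \<rho> x] by (simp add: dist_norm norm_minus_commute)
  have "uniform_limit (cball x e) (\<lambda>N \<rho>. \<Sum>k<N. ?d k \<rho>) (\<lambda>\<rho>. \<Sum>k. ?d k \<rho>) sequentially"
  proof (rule Weierstrass_m_test)
    show "summable (\<lambda>k. 8 * (3 * (cmod x + e)) ^ k)"
      using e by (intro summable_mult summable_geometric) auto
    fix k \<rho> assume "\<rho> \<in> cball x e"
    then show "norm (?d k \<rho>) \<le> 8 * (3 * (cmod x + e)) ^ k"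
      using le e by (intro order_trans[OF norm_ratio_diff_geometric] mult_left_mono power_mono) force+
  qed
  then have "uniform_limit (cball x e) (\<lambda>N \<rho>. ratio \<rho> 0 + (\<Sum>k<N. ?d k \<rho>)) eigval sequentially"
    unfolding eigval_def by (intro uniform_limit_intros)
  then show "\<exists>d>0. cball x d \<subseteq> ball 0 (1 / 3) \<and>
      uniform_limit (cball x d) (\<lambda>N \<rho>. ratio \<rho> 0 + (\<Sum>k<N. ?d k \<rho>)) eigval sequentially"
    using e le by (intro exI[of _ e]) force
qed simp

lemma ratio_tendsto_eigval:
  assumes \<rho>: "cmod \<rho> < 1 / 3"
  shows "ratio \<rho> \<longlonglongrightarrow> eigval \<rho>"
proof -
  have "summable (\<lambda>k. ratio \<rho> (Suc k) - ratio \<rho> k)"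
  proof (rule summable_comparison_test')
    show "summable (\<lambda>k. 8 * (3 * cmod \<rho>) ^ k)"
      using \<rho> by (intro summable_mult summable_geometric) auto
  qed (rule norm_ratio_diff_geometric[OF \<rho>])
  then have "(\<lambda>n. ratio \<rho> 0 + (\<Sum>k<n. ratio \<rho> (Suc k) - ratio \<rho> k)) \<longlonglongrightarrow> eigval \<rho>"
    unfolding eigval_def by (intro tendsto_add tendsto_const summable_LIMSEQ)
  then show ?thesis by (simp add: sum_lessThan_telescope)
qed

lemma iter_converges:
  assumes \<rho>: "cmod \<rho> < 1 / 3"
  obtains V where "iter \<rho> \<longlonglongrightarrow> V"
proof -
  have "summable (\<lambda>k. iter \<rho> (Suc k) - iter \<rho> k)"
  proof (rule summable_comparison_test')
    show "summable (\<lambda>k. 8 * (3 * cmod \<rho>) ^ k)"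
      using \<rho> by (intro summable_mult summable_geometric) auto
  qed (rule norm_iter_diff_geometric[OF \<rho>])
  then have "(\<lambda>n. iter \<rho> 0 + (\<Sum>k<n. iter \<rho> (Suc k) - iter \<rho> k)) \<longlonglongrightarrow> iter \<rho> 0 + (\<Sum>k. iter \<rho> (Suc k) - iter \<rho> k)"
    by (intro tendsto_add tendsto_const summable_LIMSEQ)
  then have "iter \<rho> \<longlonglongrightarrow> iter \<rho> 0 + (\<Sum>k. iter \<rho> (Suc k) - iter \<rho> k)"
    unfolding sum_lessThan_telescope by simp
  then show ?thesis by (rule that)
qed

section \<open>Real parameters and the largest eigenvalue\<close>

lemma summable_real_term:
  assumes "\<bar>t\<bar> < 1"
  shows "summable (\<lambda>n. (t ^ n * inner f (h n)) *\<^sub>R h n)"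
  using bounded_linear.summable[OF bounded_linear_fst summable_term[of "of_real t" "(f, 0)"]] assms
  by (simp add: cscale_def)

lemma Mop_of_real:
  assumes "\<bar>t\<bar> < 1"
  shows "Mop (of_real t) (f, 0) = (Mreal t f, 0)"
proof -
  have *: "cscale (of_real t ^ n * of_real x) (g, 0) = ((t ^ n * x) *\<^sub>R g, 0)" for n x and g :: 'a
    by (simp add: cscale_of_real flip: of_real_power of_real_mult)
  have "(\<lambda>n. ((t ^ n * inner f (h n)) *\<^sub>R h n, 0 :: 'a)) sums (Mreal t f, 0)"
    unfolding Mreal_def using summable_sums[OF summable_real_term[OF assms]]
    by (simp add: sums_def sum_prod tendsto_Pair)
  then show ?thesis
    unfolding Mop_def cinner_real * by (rule sums_unique[symmetric])
qed

text \<open>For a real parameter the iterates stay real, so their limit is a real vector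
  \<open>F\<close>. The normalisation and the norm bound pass to the limit and place
  \<open>F\<close> in the cone, which later identifies its eigenvalue as the largest.\<close>

lemma Mreal_eigenvector:
  assumes t: "\<bar>t\<bar> < 1 / 3"
  obtains F where "eigval (of_real t) = of_real (inner (Mreal t F) (h 0))"
    and "Mreal t F = inner (Mreal t F) (h 0) *\<^sub>R F" and "inner F (h 0) = 1" and "norm F \<le> 2"
proof -
  define \<rho> where "\<rho> = complex_of_real t"
  have \<rho>: "cmod \<rho> < 1 / 3" and t1: "\<bar>t\<bar> < 1" using t by (auto simp: \<rho>_def)
  obtain V where V: "iter \<rho> \<longlonglongrightarrow> V" using iter_converges[OF \<rho>] .
  have snd0: "snd (iter \<rho> k) = 0" for k
  proof (induction k)
    case (Suc k)
    then obtain f where f: "iter \<rho> k = (f, 0)" by (metis prod.collapse)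
    have M: "Mop \<rho> (f, 0) = (Mreal t f, 0)" unfolding \<rho>_def by (rule Mop_of_real[OF t1])
    have "iter \<rho> (Suc k) = cscale (of_real (1 / inner (Mreal t f) (h 0))) (Mreal t f, 0)"
      by (simp add: f M)
    then show ?case by (simp only: cscale_of_real snd_scaleR) simp
  qed simp
  have "snd V = 0"
    using LIMSEQ_unique[OF tendsto_snd[OF V]] snd0 by simp
  then obtain F where F: "V = (F, 0)" by (metis prod.collapse)
  have MV: "Mop \<rho> V = (Mreal t F, 0)" unfolding F \<rho>_def by (rule Mop_of_real[OF t1])
  have Abound: "norm (Aop \<rho> z) \<le> norm z" for z
  proof -
    have "3 / 4 * cmod \<rho> * norm z \<le> 1 * norm z" using \<rho> by (intro mult_right_mono) auto
    then show ?thesis using norm_Aop[OF \<rho>, of z] by simp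
  qed
  have cV: "(\<lambda>k. cinner (iter \<rho> k) g) \<longlonglongrightarrow> cinner V g" for g
    by (rule bounded_linear.tendsto[OF bounded_linear_cinner V])
  have "cinner V (h 0) = 1"
    using LIMSEQ_unique[OF cV[of "h 0"]] iter_normalised(1)[OF \<rho>] by simp
  then have 3: "inner F (h 0) = 1" by (simp add: F complex_eq_iff)
  have "norm V \<le> 2"
    by (rule LIMSEQ_le_const2[OF tendsto_norm[OF V]]) (use iter_normalised(2)[OF \<rho>] in auto)
  then have 4: "norm F \<le> 2" by (simp add: F)
  \<comment> \<open>\<open>Aop\<close> is Lipschitz and the rank-one term is constant along the
    iteration, so \<open>Mop\<close> passes to the limit.\<close>
  have "(\<lambda>k. Aop \<rho> (iter \<rho> k)) \<longlonglongrightarrow> Aop \<rho> V"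
  proof (rule LIM_zero_cancel, rule Lim_null_comparison)
    show "\<forall>\<^sub>F k in sequentially. norm (Aop \<rho> (iter \<rho> k) - Aop \<rho> V) \<le> norm (iter \<rho> k - V)"
      using Abound \<rho> by (simp add: Aop_diff[symmetric])
    show "(\<lambda>k. norm (iter \<rho> k - V)) \<longlonglongrightarrow> 0"
      using V by (simp add: LIM_zero tendsto_norm_zero)
  qed
  moreover have "(\<lambda>k. cscale (cinner (iter \<rho> k) (h 0)) (h 0, 0)) \<longlonglongrightarrow> cscale (cinner V (h 0)) (h 0, 0)"
    using iter_normalised(1)[OF \<rho>] \<open>cinner V (h 0) = 1\<close> by simp
  ultimately have MT: "(\<lambda>k. Mop \<rho> (iter \<rho> k)) \<longlonglongrightarrow> Mop \<rho> V"
    using \<rho> by (simp add: Mop_eq tendsto_add)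
  have "ratio \<rho> \<longlonglongrightarrow> cinner (Mop \<rho> V) (h 0)"
    unfolding ratio_def by (rule bounded_linear.tendsto[OF bounded_linear_cinner MT])
  then have "eigval \<rho> = cinner (Mop \<rho> V) (h 0)"
    by (rule LIMSEQ_unique[OF ratio_tendsto_eigval[OF \<rho>]])
  then have 1: "eigval \<rho> = of_real (inner (Mreal t F) (h 0))" by (simp add: MV)
  \<comment> \<open>The limit in the eigenvector equation is taken after pairing with
    \<open>g\<close>, where it concerns products of complex numbers.\<close>
  have "(\<lambda>k. cinner (cscale (ratio \<rho> k) (iter \<rho> (Suc k))) g) \<longlonglongrightarrow> eigval \<rho> * cinner V g" for g
    unfolding cinner_cscale by (intro tendsto_mult ratio_tendsto_eigval \<rho> LIMSEQ_Suc cV)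
  then have "(\<lambda>k. cinner (Mop \<rho> (iter \<rho> k)) g) \<longlonglongrightarrow> eigval \<rho> * cinner V g" for g
    by (simp add: cscale_ratio_iter[OF \<rho>] del: iter.simps)
  then have weak: "eigval \<rho> * cinner V g = cinner (Mop \<rho> V) g" for g
    using LIMSEQ_unique bounded_linear.tendsto[OF bounded_linear_cinner MT] by blast
  then have "inner (Mreal t F) g = inner (inner (Mreal t F) (h 0) *\<^sub>R F) g" for g
  proof -
    have "complex_of_real (inner (Mreal t F) g) = of_real (inner (Mreal t F) (h 0) * inner F g)"
      using weak[of g] unfolding 1 F MV[unfolded F] cinner_real by simp
    then show ?thesis unfolding of_real_eq_iff by simp
  qed
  then have 2: "Mreal t F = inner (Mreal t F) (h 0) *\<^sub>R F"
    using vector_eq_rdot by blast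
  show ?thesis using that[OF 1[unfolded \<rho>_def] 2 3 4] .
qed

lemma Mreal_selfadjoint:
  assumes "\<bar>t\<bar> < 1"
  shows "inner (Mreal t f) g = inner f (Mreal t g)"
proof -
  have "inner (Mreal t f) g = (\<Sum>n. t ^ n * inner f (h n) * inner (h n) g)" for f g
    unfolding Mreal_def
    by (subst bounded_linear.suminf[OF bounded_linear_inner_left summable_real_term[OF assms]]) simp
  from this[of f g] this[of g f] show ?thesis by (simp add: inner_commute mult_ac)
qed

lemma Mreal_minus_norm:
  assumes t: "\<bar>t\<bar> < 1 / 3" and f: "f \<noteq> 0"
  shows "(norm (Mreal t f - inner f (h 0) *\<^sub>R h 0))\<^sup>2 < (norm f)\<^sup>2 / 16"
proof -
  define \<rho> where "\<rho> = complex_of_real t"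
  have \<rho>: "cmod \<rho> < 1 / 3" "cmod \<rho> < 1" "\<bar>t\<bar> < 1" using t by (auto simp: \<rho>_def)
  have "Aop \<rho> (f, 0) = (Mreal t f - inner f (h 0) *\<^sub>R h 0, 0)"
    using Mop_eq[OF \<rho>(2), of "(f, 0)"] Mop_of_real[OF \<rho>(3), of f]
    by (simp add: \<rho>_def[symmetric] cscale_of_real algebra_simps prod_eq_iff)
  then have "norm (Mreal t f - inner f (h 0) *\<^sub>R h 0) \<le> 3 / 4 * cmod \<rho> * norm f"
    using norm_Aop[OF \<rho>(1), of "(f, 0)"] by simp
  also have "\<dots> < 1 / 4 * norm f"
    using \<rho> f by (intro mult_strict_right_mono) auto
  finally have "(norm (Mreal t f - inner f (h 0) *\<^sub>R h 0))\<^sup>2 < (1 / 4 * norm f)\<^sup>2"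
    by (rule power_strict_mono) auto
  then show ?thesis by (simp add: power2_eq_square)
qed

text \<open>On an eigenvector the perturbation equals
  \<open>l *\<^sub>R f - inner f (h 0) *\<^sub>R h 0\<close>. Expanding its squared norm and
  applying \<open>Mreal_minus_norm\<close> constrains \<open>l\<close> in terms of the share of
  \<open>h 0\<close> in \<open>f\<close>.\<close>

lemma eigenvector_norm_ineq:
  assumes t: "\<bar>t\<bar> < 1 / 3" and f: "f \<noteq> 0" and eig: "Mreal t f = l *\<^sub>R f"
  shows "l\<^sup>2 * (norm f)\<^sup>2 - 2 * l * (inner f (h 0))\<^sup>2 + (inner f (h 0))\<^sup>2 / 2 < (norm f)\<^sup>2 / 16"
proof -
  have "(norm (l *\<^sub>R f - inner f (h 0) *\<^sub>R h 0))\<^sup>2 =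
      l\<^sup>2 * (norm f)\<^sup>2 - 2 * l * (inner f (h 0))\<^sup>2 + (inner f (h 0))\<^sup>2 / 2"
    unfolding power2_norm_eq_inner
    by (simp add: inner_diff_left inner_diff_right inner_h_self inner_commute[of "h 0" f]
        power2_eq_square algebra_simps)
  then show ?thesis using Mreal_minus_norm[OF t f] by (simp add: eig)
qed

text \<open>The eigenvector \<open>F\<close> lies in the cone, which forces its eigenvalue above
  1/4. An eigenvector of a larger eigenvalue would be orthogonal to \<open>F\<close>, hence in the
  complementary cone, where the norm inequality makes a square negative.\<close>

lemma top_eigenvalue_power_series:
  "\<exists>K. \<forall>t. \<bar>t\<bar> < 1 / 3 \<longrightarrow> (\<exists>l. (\<lambda>n. K n * t ^ n) sums l \<and> (\<exists>f. f \<noteq> 0 \<and> Mreal t f = l *\<^sub>R f) \<and>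
      (\<forall>l' g. g \<noteq> 0 \<longrightarrow> Mreal t g = l' *\<^sub>R g \<longrightarrow> l' \<le> l))"
proof -
  \<comment> \<open>Taylor coefficients at 0; their real parts suffice because \<open>eigval\<close>
    is real at real points.\<close>
  define c where "c n = (deriv ^^ n) eigval 0 / fact n" for n
  show ?thesis
  proof (intro exI[of _ "\<lambda>n. Re (c n)"] allI impI)
    fix t :: real assume t: "\<bar>t\<bar> < 1 / 3"
    obtain F where F: "eigval (of_real t) = of_real (inner (Mreal t F) (h 0))"
      "Mreal t F = inner (Mreal t F) (h 0) *\<^sub>R F" "inner F (h 0) = 1" "norm F \<le> 2"
      using Mreal_eigenvector[OF t] .
    define l where "l = inner (Mreal t F) (h 0)"
    have eig: "Mreal t F = l *\<^sub>R F" using F(2) by (simp add: l_def)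
    have F0: "F \<noteq> 0" using F(3) by auto
    have "(\<lambda>n. c n * (of_real t - 0) ^ n) sums eigval (of_real t)"
      unfolding c_def using t by (intro holomorphic_power_series[OF holomorphic_eigval]) auto
    then have "(\<lambda>n. Re (c n * (of_real t - 0) ^ n)) sums Re (eigval (of_real t))"
      by (rule sums_Re)
    then have sums: "(\<lambda>n. Re (c n) * t ^ n) sums l"
      by (simp add: F(1) l_def flip: of_real_power)
    \<comment> \<open>\<open>N\<close> lies between 2 and 4: the upper bound is the cone condition,
      the lower one is Cauchy-Schwarz against \<open>h 0\<close>.\<close>
    define N where "N = (norm F)\<^sup>2"
    have "N \<le> 4" using power_mono[OF F(4), of 2] by (simp add: N_def)
    have "1 \<le> norm F * norm (h 0)" using norm_cauchy_schwarz[of F "h 0"] F(3) by simp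
    then have "1 \<le> (norm F * norm (h 0))\<^sup>2" using power_mono[of 1 _ 2] by fastforce
    then have "N \<ge> 2" by (simp add: power_mult_distrib norm_h_sq N_def)
    have ineq: "l\<^sup>2 * N - 2 * l + 1 / 2 < N / 16"
      using eigenvector_norm_ineq[OF t F0 eig] F(3) by (simp add: N_def)
    have l: "l > 1 / 4"
    proof (rule ccontr)
      assume "\<not> l > 1 / 4"
      then have l4: "l \<le> 1 / 4" by simp
      \<comment> \<open>In the first case the coefficient of \<open>N\<close> in \<open>ineq\<close>
        is at most 0, so \<open>N = 4\<close> is extremal and turns the left side into a square. In
        the second case all summands of \<open>l\<^sup>2 * N - N / 16 - 2 * l + 1 / 2\<close> are
        nonnegative once the first two are combined.\<close>
      have "l\<^sup>2 \<le> 1 / 16 \<or> l < - (1 / 4)"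
      proof (cases "l < - (1 / 4)")
        case False
        then have "\<bar>l\<bar> \<le> 1 / 4" using l4 by simp
        then have "\<bar>l\<bar>\<^sup>2 \<le> (1 / 4)\<^sup>2" by (intro power_mono) auto
        then show ?thesis by (simp add: power2_eq_square)
      qed simp
      then show False
      proof
        assume "l\<^sup>2 \<le> 1 / 16"
        then have "(l\<^sup>2 - 1 / 16) * 4 \<le> (l\<^sup>2 - 1 / 16) * N"
          using \<open>N \<le> 4\<close> by (intro mult_left_mono_neg) auto
        then have "(2 * l - 1 / 2)\<^sup>2 < 0"
          using ineq by (simp add: power2_eq_square algebra_simps)
        then show False using zero_le_power2[of "2 * l - 1 / 2"] by linarith
      next
        assume l0: "l < - (1 / 4)"
        then have "(1 / 4)\<^sup>2 \<le> (- l)\<^sup>2" by (intro power_mono) auto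
        then have "N * (1 / 16) \<le> N * l\<^sup>2" using \<open>N \<ge> 2\<close> by (intro mult_left_mono) (auto simp: power2_eq_square)
        then show False using ineq l0 by (simp add: mult.commute)
      qed
    qed
    show "\<exists>l. (\<lambda>n. Re (c n) * t ^ n) sums l \<and> (\<exists>f. f \<noteq> 0 \<and> Mreal t f = l *\<^sub>R f) \<and>
        (\<forall>l' g. g \<noteq> 0 \<longrightarrow> Mreal t g = l' *\<^sub>R g \<longrightarrow> l' \<le> l)"
    proof (intro exI[of _ l] conjI allI impI sums exI[of _ F] F0 eig)
      fix l' g assume g: "g \<noteq> 0" and eig': "Mreal t g = l' *\<^sub>R g"
      show "l' \<le> l"
      proof (rule ccontr)
        assume "\<not> l' \<le> l"
        then have l': "l' > l" by simp
        define x where "x = inner g (h 0)"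
        define N' where "N' = (norm g)\<^sup>2"
        have "N' > 0" using g by (simp add: N'_def)
        have "l * inner F g = l' * inner F g"
          using Mreal_selfadjoint[of t F g] t by (simp add: eig eig')
        then have orth: "inner F g = 0" using l' by simp
        \<comment> \<open>The components of \<open>F\<close> and \<open>g\<close> along
          \<open>h 0\<close> are \<open>2 *\<^sub>R h 0\<close> and
          \<open>(2 * x) *\<^sub>R h 0\<close>. By orthogonality of \<open>F\<close> and
          \<open>g\<close>, the pairing of the remaining parts cancels that of these components, and
          Cauchy-Schwarz then bounds \<open>x\<close>.\<close>
        have "- (2 * x) = inner (F - 2 *\<^sub>R h 0) (g - (2 * x) *\<^sub>R h 0)"
          using F(3) by (simp add: inner_diff_left inner_diff_right orth inner_h_self x_def inner_commute[of "h 0"])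
        then have "(2 * x)\<^sup>2 \<le> (norm (F - 2 *\<^sub>R h 0))\<^sup>2 * (norm (g - (2 * x) *\<^sub>R h 0))\<^sup>2"
          using Cauchy_Schwarz_ineq[of "F - 2 *\<^sub>R h 0" "g - (2 * x) *\<^sub>R h 0"]
          by (metis power2_minus power2_norm_eq_inner)
        also have "(norm (F - 2 *\<^sub>R h 0))\<^sup>2 = N - 2"
          using F(3) unfolding N_def power2_norm_eq_inner
          by (simp add: inner_diff_left inner_diff_right inner_h_self inner_commute[of "h 0"])
        also have "(norm (g - (2 * x) *\<^sub>R h 0))\<^sup>2 = N' - 2 * x\<^sup>2"
          unfolding N'_def power2_norm_eq_inner
          by (simp add: inner_diff_left inner_diff_right inner_h_self inner_commute[of "h 0"] x_def
              power2_eq_square)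
        finally have "(2 * x)\<^sup>2 \<le> (N - 2) * (N' - 2 * x\<^sup>2)" .
        also have "\<dots> \<le> 2 * (N' - 2 * x\<^sup>2)"
        proof (rule mult_right_mono)
          show "0 \<le> N' - 2 * x\<^sup>2"
            using \<open>(norm (g - (2 * x) *\<^sub>R h 0))\<^sup>2 = N' - 2 * x\<^sup>2\<close> by (metis zero_le_power2)
        qed (use \<open>N \<le> 4\<close> in simp)
        finally have x: "x\<^sup>2 \<le> N' / 4" by (simp add: power_mult_distrib)
        have "l'\<^sup>2 * N' - 2 * l' * x\<^sup>2 + x\<^sup>2 / 2 < N' / 16"
          using eigenvector_norm_ineq[OF t g eig'] by (simp add: N'_def x_def)
        \<comment> \<open>As \<open>l' > 1 / 4\<close>, the factor is negative, so the worst case is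
          \<open>x\<^sup>2 = N' / 4\<close>; what is left is \<open>N'\<close> times the square of
          \<open>l' - 1 / 4\<close>.\<close>
        moreover have "(1 / 2 - 2 * l') * (N' / 4) \<le> (1 / 2 - 2 * l') * x\<^sup>2"
          using l l' x by (intro mult_left_mono_neg) auto
        ultimately have "N' * (l' - 1 / 4)\<^sup>2 < 0"
          by (simp add: power2_eq_square algebra_simps)
        then show False
          using \<open>N' > 0\<close> zero_le_power2[of "l' - 1 / 4"] by (simp add: mult_less_0_iff)
      qed
    qed
  qed
qed

end

section \<open>The Hilbert space over the half line\<close>

text \<open>A subsequence with steps below powers of 1/2 turns a Cauchy sequence into an absolutely
  summable telescoping series.\<close>

lemma convergent_if_absolutely_summable:
  fixes X :: "nat \<Rightarrow> 'a::real_normed_vector"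
  assumes abs: "\<And>f :: nat \<Rightarrow> 'a. summable (\<lambda>n. norm (f n)) \<Longrightarrow> summable f" and X: "Cauchy X"
  shows "convergent X"
proof -
  have "\<forall>n. \<exists>N. \<forall>m\<ge>N. \<forall>k\<ge>N. norm (X m - X k) < (1 / 2) ^ n"
    using X by (auto simp: Cauchy_iff)
  then obtain N where N: "\<And>n m k. m \<ge> N n \<Longrightarrow> k \<ge> N n \<Longrightarrow> norm (X m - X k) < (1 / 2) ^ n"
    by metis
  \<comment> \<open>Partial sums dominate \<open>N n\<close> at both \<open>n\<close> and
    \<open>Suc n\<close>, although \<open>N\<close> may fail to be monotone.\<close>
  define s where "s n = (\<Sum>i\<le>n. N i)" for n
  have s: "N n \<le> s n" "N n \<le> s (Suc n)" for n
    unfolding s_def by (rule member_le_sum; simp)+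
  have "summable (\<lambda>n. norm (X (s (Suc n)) - X (s n)))"
  proof (rule summable_comparison_test')
    show "summable (\<lambda>n. (1 / 2 :: real) ^ n)" by (rule summable_geometric) simp
    show "norm (norm (X (s (Suc n)) - X (s n))) \<le> (1 / 2) ^ n" for n
      using N[OF s(2,1)[of n]] by simp
  qed
  then have "summable (\<lambda>n. X (s (Suc n)) - X (s n))" by (rule abs)
  then have "(\<lambda>n. X (s 0) + (\<Sum>i<n. X (s (Suc i)) - X (s i))) \<longlonglongrightarrow> X (s 0) + (\<Sum>i. X (s (Suc i)) - X (s i))"
    by (intro tendsto_add tendsto_const summable_LIMSEQ)
  then obtain L where L: "(\<lambda>n. X (s n)) \<longlonglongrightarrow> L"
    unfolding sum_lessThan_telescope[of "\<lambda>i. X (s i)"] by auto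
  have "X \<longlonglongrightarrow> L"
  proof (rule LIMSEQ_I)
    fix e :: real assume e: "e > 0"
    have "(\<lambda>n. (1 / 2 :: real) ^ n) \<longlonglongrightarrow> 0" by (rule LIMSEQ_power_zero) simp
    then have "\<forall>\<^sub>F n in sequentially. (1 / 2 :: real) ^ n < e / 2"
      by (rule order_tendstoD) (use e in simp)
    moreover have "\<forall>\<^sub>F n in sequentially. dist (X (s n)) L < e / 2"
      using L by (rule tendstoD) (use e in simp)
    ultimately have "\<forall>\<^sub>F n in sequentially. (1 / 2 :: real) ^ n < e / 2 \<and> dist (X (s n)) L < e / 2"
      by (rule eventually_conj)
    then obtain n where n: "(1 / 2 :: real) ^ n < e / 2" "dist (X (s n)) L < e / 2"
      using eventually_happens'[OF sequentially_bot] by blast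
    show "\<exists>m0. \<forall>m\<ge>m0. norm (X m - L) < e"
    proof (intro exI allI impI)
      fix m assume "m \<ge> N n"
      then have "norm (X m - X (s n)) < e / 2" using N[OF _ s(1)] n(1) by fastforce
      then show "norm (X m - L) < e"
        using n(2) norm_triangle_ineq[of "X m - X (s n)" "X (s n) - L"] by (simp add: dist_norm)
    qed
  qed
  then show ?thesis by (rule convergentI)
qed

section \<open>Square-integrable functions\<close>

lemma L2_measurable [measurable_dest]: "f \<in> L2 M \<Longrightarrow> f \<in> borel_measurable M"
  by (simp add: L2_def)

lemma L2_integrable_square: "f \<in> L2 M \<Longrightarrow> integrable M (\<lambda>x. (f x)\<^sup>2)"
  by (simp add: L2_def)

lemma L2_integrable_mult:
  assumes "f \<in> L2 M" "g \<in> L2 M"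
  shows "integrable M (\<lambda>x. f x * g x)"
proof (rule Bochner_Integration.integrable_bound)
  show "integrable M (\<lambda>x. (f x)\<^sup>2 + (g x)\<^sup>2)"
    using assms by (intro Bochner_Integration.integrable_add L2_integrable_square)
  show "(\<lambda>x. f x * g x) \<in> borel_measurable M"
    using assms by measurable
  have "\<bar>a * b\<bar> \<le> a\<^sup>2 + b\<^sup>2" for a b :: real
  proof -
    have "2 * (\<bar>a\<bar> * \<bar>b\<bar>) \<le> a\<^sup>2 + b\<^sup>2" "0 \<le> \<bar>a\<bar> * \<bar>b\<bar>"
      using sum_squares_bound[of "\<bar>a\<bar>" "\<bar>b\<bar>"] by (simp_all add: mult.assoc)
    then show ?thesis unfolding abs_mult by linarith
  qed
  then show "AE x in M. norm (f x * g x) \<le> norm ((f x)\<^sup>2 + (g x)\<^sup>2)" by simp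
qed

lemma L2_scale: "f \<in> L2 M \<Longrightarrow> (\<lambda>x. c * f x) \<in> L2 M"
  by (auto simp: L2_def power_mult_distrib)

lemma L2_add:
  assumes "f \<in> L2 M" "g \<in> L2 M"
  shows "(\<lambda>x. f x + g x) \<in> L2 M"
proof -
  have "integrable M (\<lambda>x. (f x)\<^sup>2 + (g x)\<^sup>2 + 2 * (f x * g x))"
    using assms by (intro Bochner_Integration.integrable_add L2_integrable_square
        integrable_mult_right L2_integrable_mult)
  then show ?thesis
    using assms by (auto simp: L2_def power2_sum mult.assoc)
qed

lemma L2_uminus: "f \<in> L2 M \<Longrightarrow> (\<lambda>x. - f x) \<in> L2 M"
  by (simp add: L2_def)

lemma L2_diff: "f \<in> L2 M \<Longrightarrow> g \<in> L2 M \<Longrightarrow> (\<lambda>x. f x - g x) \<in> L2 M"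
  using L2_add[OF _ L2_uminus, of f M g] by simp

lemma L2_zero: "(\<lambda>x. 0) \<in> L2 M"
  by (simp add: L2_def)

lemma L2_abs: "f \<in> L2 M \<Longrightarrow> (\<lambda>x. \<bar>f x\<bar>) \<in> L2 M"
  by (auto simp: L2_def)

lemma L2_sum: "(\<And>i. i \<in> I \<Longrightarrow> f i \<in> L2 M) \<Longrightarrow> (\<lambda>x. \<Sum>i\<in>I. f i x) \<in> L2 M"
  by (induction I rule: infinite_finite_induct) (auto simp: L2_zero L2_add)

\<comment> \<open>The quotient by almost-everywhere equality\<close>
\<comment> \<open>The locale \<open>rank_one_series\<close> asks for a type that is an inner product
  and Banach space, in which only 0 has norm 0; hence the passage to classes. The relation is
  partial, so functions outside \<open>L2\<close> belong to no class.\<close>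
quotient_type hilb = "real \<Rightarrow> real" / partial:
  "\<lambda>f g. f \<in> L2 half_gaussian \<and> g \<in> L2 half_gaussian \<and> (AE x in half_gaussian. f x = g x)"
proof (rule part_equivpI)
  show "\<exists>f. f \<in> L2 half_gaussian \<and> f \<in> L2 half_gaussian \<and> (AE x in half_gaussian. f x = f x)"
    using L2_zero by auto
qed (auto intro!: sympI transpI)

instantiation hilb :: real_vector
begin

lift_definition zero_hilb :: hilb is "\<lambda>x. 0"
  by (simp add: L2_zero)

lift_definition plus_hilb :: "hilb \<Rightarrow> hilb \<Rightarrow> hilb" is "\<lambda>f g x. f x + g x"
  by (auto simp: L2_add)

lift_definition minus_hilb :: "hilb \<Rightarrow> hilb \<Rightarrow> hilb" is "\<lambda>f g x. f x - g x"
  by (auto simp: L2_diff)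

lift_definition uminus_hilb :: "hilb \<Rightarrow> hilb" is "\<lambda>f x. - f x"
  by (auto simp: L2_uminus)

lift_definition scaleR_hilb :: "real \<Rightarrow> hilb \<Rightarrow> hilb" is "\<lambda>c f x. c * f x"
  by (auto simp: L2_scale)

instance
  by standard
    (transfer, auto simp: L2_zero L2_add L2_diff L2_uminus L2_scale algebra_simps)+

end

instantiation hilb :: real_inner
begin

lift_definition inner_hilb :: "hilb \<Rightarrow> hilb \<Rightarrow> real" is "\<lambda>f g. LINT x|half_gaussian. f x * g x"
proof -
  fix f f' g g' :: "real \<Rightarrow> real"
  assume 1: "f \<in> L2 half_gaussian \<and> f' \<in> L2 half_gaussian \<and> (AE x in half_gaussian. f x = f' x)"
    and 2: "g \<in> L2 half_gaussian \<and> g' \<in> L2 half_gaussian \<and> (AE x in half_gaussian. g x = g' x)"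
  have [measurable]: "f \<in> borel_measurable half_gaussian" "f' \<in> borel_measurable half_gaussian"
    "g \<in> borel_measurable half_gaussian" "g' \<in> borel_measurable half_gaussian"
    using 1 2 by (auto simp: L2_def)
  show "(LINT x|half_gaussian. f x * g x) = (LINT x|half_gaussian. f' x * g' x)"
    using 1 2 by (intro integral_cong_AE) auto
qed

definition norm_hilb :: "hilb \<Rightarrow> real" where "norm_hilb f = sqrt (inner f f)"

definition sgn_hilb :: "hilb \<Rightarrow> hilb" where "sgn_hilb f = f /\<^sub>R norm f"

definition dist_hilb :: "hilb \<Rightarrow> hilb \<Rightarrow> real" where "dist_hilb f g = norm (f - g)"

definition uniformity_hilb :: "(hilb \<times> hilb) filter" where
  "uniformity_hilb = (INF e\<in>{0<..}. principal {(f, g). dist f g < e})"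

definition open_hilb :: "hilb set \<Rightarrow> bool" where
  "open_hilb U = (\<forall>x\<in>U. \<forall>\<^sub>F (x', y) in uniformity. x' = x \<longrightarrow> y \<in> U)"

instance
proof
  fix f g k :: hilb and c :: real and U :: "hilb set"
  show "inner f g = inner g f"
    by transfer (simp add: mult.commute)
  show "inner (f + g) k = inner f k + inner g k"
    by transfer (simp add: distrib_right L2_integrable_mult)
  show "inner (c *\<^sub>R f) g = c * inner f g"
    by transfer (simp add: mult.assoc)
  show "0 \<le> inner f f"
    by transfer simp
  show "inner f f = 0 \<longleftrightarrow> f = 0"
  proof transfer
    fix f :: "real \<Rightarrow> real"
    assume f: "f \<in> L2 half_gaussian \<and> f \<in> L2 half_gaussian \<and> (AE x in half_gaussian. f x = f x)"
    then have "integrable half_gaussian (\<lambda>x. f x * f x)" by (intro L2_integrable_mult) auto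
    then have "(LINT x|half_gaussian. f x * f x) = 0 \<longleftrightarrow> (AE x in half_gaussian. f x * f x = 0)"
      by (rule integral_nonneg_eq_0_iff_AE) simp
    then show "(LINT x|half_gaussian. f x * f x) = 0 \<longleftrightarrow>
        f \<in> L2 half_gaussian \<and> (\<lambda>x. 0) \<in> L2 half_gaussian \<and> (AE x in half_gaussian. f x = 0)"
      using f by (simp add: L2_zero)
  qed
qed (rule norm_hilb_def sgn_hilb_def dist_hilb_def uniformity_hilb_def open_hilb_def)+

end

lemma L2_rep_hilb: "rep_hilb f \<in> L2 half_gaussian"
  using Quotient_rep_reflp[OF Quotient_hilb, of f] by simp

lemma abs_rep_hilb [simp]: "abs_hilb (rep_hilb f) = f"
  by (rule Quotient_abs_rep[OF Quotient_hilb])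

lemma abs_hilb_eq_iff:
  assumes "f \<in> L2 half_gaussian" "g \<in> L2 half_gaussian"
  shows "abs_hilb f = abs_hilb g \<longleftrightarrow> (AE x in half_gaussian. f x = g x)"
  using Quotient_rel[OF Quotient_hilb, of f g] assms by auto

lemma inner_abs_hilb:
  assumes "f \<in> L2 half_gaussian" "g \<in> L2 half_gaussian"
  shows "inner (abs_hilb f) (abs_hilb g) = (LINT x|half_gaussian. f x * g x)"
  using assms by (subst inner_hilb.abs_eq) auto

lemma scaleR_abs_hilb:
  "f \<in> L2 half_gaussian \<Longrightarrow> c *\<^sub>R abs_hilb f = abs_hilb (\<lambda>x. c * f x)"
  by (subst scaleR_hilb.abs_eq) auto

lemma add_abs_hilb:
  "f \<in> L2 half_gaussian \<Longrightarrow> g \<in> L2 half_gaussian \<Longrightarrow> abs_hilb f + abs_hilb g = abs_hilb (\<lambda>x. f x + g x)"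
  by (subst plus_hilb.abs_eq) auto

lemma diff_abs_hilb:
  "f \<in> L2 half_gaussian \<Longrightarrow> g \<in> L2 half_gaussian \<Longrightarrow> abs_hilb f - abs_hilb g = abs_hilb (\<lambda>x. f x - g x)"
  by (subst minus_hilb.abs_eq) auto

lemma sum_abs_hilb:
  "(\<And>i. i \<in> I \<Longrightarrow> f i \<in> L2 half_gaussian) \<Longrightarrow> (\<Sum>i\<in>I. abs_hilb (f i)) = abs_hilb (\<lambda>x. \<Sum>i\<in>I. f i x)"
  by (induction I rule: infinite_finite_induct) (auto simp: zero_hilb_def add_abs_hilb L2_sum)

lemma norm_abs_hilb_sq:
  "f \<in> L2 half_gaussian \<Longrightarrow> (norm (abs_hilb f))\<^sup>2 = (LINT x|half_gaussian. (f x)\<^sup>2)"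
  unfolding power2_norm_eq_inner by (simp add: inner_abs_hilb power2_eq_square)

lemma norm_abs_hilb_abs:
  assumes "f \<in> L2 half_gaussian"
  shows "norm (abs_hilb (\<lambda>x. \<bar>f x\<bar>)) = norm (abs_hilb f)"
proof (rule power2_eq_imp_eq)
  show "(norm (abs_hilb (\<lambda>x. \<bar>f x\<bar>)))\<^sup>2 = (norm (abs_hilb f))\<^sup>2"
    using assms by (simp add: norm_abs_hilb_sq L2_abs)
qed simp_all

section \<open>Absolutely convergent series in \<open>hilb\<close> and completeness\<close>

text \<open>The Riesz-Fischer argument. Monotone convergence bounds the partial sums of absolute
  values in mean square, so they converge almost everywhere to an envelope \<open>G\<close> with
  integrable square. Dominated convergence then yields convergence in norm.\<close>

lemma
  fixes f :: "nat \<Rightarrow> real \<Rightarrow> real"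
  assumes f: "\<And>n. f n \<in> L2 half_gaussian" and sum: "summable (\<lambda>n. norm (abs_hilb (f n)))"
  shows AE_summable_hilb: "AE x in half_gaussian. summable (\<lambda>n. \<bar>f n x\<bar>)"
    and L2_suminf: "(\<lambda>x. \<Sum>n. f n x) \<in> L2 half_gaussian"
    and abs_hilb_sums: "(\<lambda>n. abs_hilb (f n)) sums abs_hilb (\<lambda>x. \<Sum>n. f n x)"
proof -
  have [measurable]: "f n \<in> borel_measurable half_gaussian" for n
    using f by (rule L2_measurable)
  define S where "S = (\<Sum>n. norm (abs_hilb (f n)))"
  define g where "g N x = (\<Sum>n<N. \<bar>f n x\<bar>)" for N x
  have g: "g N \<in> L2 half_gaussian" for N
    unfolding g_def[abs_def] by (intro L2_sum L2_abs f)
  have [measurable]: "g N \<in> borel_measurable half_gaussian" for N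
    using g by (rule L2_measurable)
  have g0: "0 \<le> g N x" for N x unfolding g_def by (intro sum_nonneg) simp
  have gmono: "mono (\<lambda>N. (g N x)\<^sup>2)" for x
  proof (rule monoI)
    fix m n :: nat assume "m \<le> n"
    then have "g m x \<le> g n x" unfolding g_def by (intro sum_mono2) auto
    then show "(g m x)\<^sup>2 \<le> (g n x)\<^sup>2" using g0 by (intro power_mono)
  qed
  have gS: "(LINT x|half_gaussian. (g N x)\<^sup>2) \<le> S\<^sup>2" for N
  proof -
    have "abs_hilb (g N) = (\<Sum>n<N. abs_hilb (\<lambda>x. \<bar>f n x\<bar>))"
      unfolding g_def[abs_def] by (rule sum_abs_hilb[symmetric]) (intro L2_abs f)
    then have "norm (abs_hilb (g N)) \<le> (\<Sum>n<N. norm (abs_hilb (\<lambda>x. \<bar>f n x\<bar>)))"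
      by (simp add: norm_sum)
    also have "\<dots> = (\<Sum>n<N. norm (abs_hilb (f n)))"
      by (simp add: norm_abs_hilb_abs f)
    also have "\<dots> \<le> S"
      unfolding S_def by (intro sum_le_suminf sum) auto
    finally have "(norm (abs_hilb (g N)))\<^sup>2 \<le> S\<^sup>2" by (intro power_mono) auto
    then show ?thesis by (simp add: norm_abs_hilb_sq g)
  qed
  have "(\<integral>\<^sup>+x. (SUP N. ennreal ((g N x)\<^sup>2)) \<partial>half_gaussian) = (SUP N. \<integral>\<^sup>+x. ennreal ((g N x)\<^sup>2) \<partial>half_gaussian)"
  proof (rule nn_integral_monotone_convergence_SUP)
    show "incseq (\<lambda>N x. ennreal ((g N x)\<^sup>2))"
      using gmono by (auto simp: incseq_def le_fun_def mono_def intro!: ennreal_leI)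
  qed simp
  also have "\<dots> \<le> ennreal (S\<^sup>2)"
    using gS by (intro SUP_least) (simp add: nn_integral_eq_integral L2_integrable_square g ennreal_leI)
  finally have fin: "(\<integral>\<^sup>+x. (SUP N. ennreal ((g N x)\<^sup>2)) \<partial>half_gaussian) \<noteq> \<infinity>"
    by (auto simp: top_unique)
  have "AE x in half_gaussian. (SUP N. ennreal ((g N x)\<^sup>2)) \<noteq> \<infinity>"
    by (rule nn_integral_noteq_infinite[OF _ fin]) simp
  then show AEs: "AE x in half_gaussian. summable (\<lambda>n. \<bar>f n x\<bar>)"
  proof (rule AE_mp, intro AE_I2 impI)
    fix x assume "(SUP N. ennreal ((g N x)\<^sup>2)) \<noteq> \<infinity>"
    then obtain b where b: "b \<ge> 0" "(SUP N. ennreal ((g N x)\<^sup>2)) = ennreal b"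
      by (cases "SUP N. ennreal ((g N x)\<^sup>2)") auto
    have le: "(g N x)\<^sup>2 \<le> b" for N
      using b SUP_upper[of N UNIV "\<lambda>N. ennreal ((g N x)\<^sup>2)"] by (simp add: ennreal_le_iff)
    have "(\<Sum>n<N. \<bar>f n x\<bar>) \<le> sqrt b" for N
      using le[of N] by (intro real_le_rsqrt) (simp add: g_def)
    then show "summable (\<lambda>n. \<bar>f n x\<bar>)"
      by (intro summableI_nonneg_bounded[where x = "sqrt b"]) auto
  qed
  \<comment> \<open>Where the series diverges, \<open>suminf\<close> has an unspecified value; by
    \<open>AEs\<close> this concerns a null set only.\<close>
  define G where "G x = (\<Sum>n. \<bar>f n x\<bar>)" for x
  have [measurable]: "G \<in> borel_measurable half_gaussian"
    unfolding G_def[abs_def] by measurable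
  have Gint: "integrable half_gaussian (\<lambda>x. (G x)\<^sup>2)"
  proof (rule integrableI_bounded)
    have "(\<integral>\<^sup>+x. norm ((G x)\<^sup>2) \<partial>half_gaussian) \<le> (\<integral>\<^sup>+x. (SUP N. ennreal ((g N x)\<^sup>2)) \<partial>half_gaussian)"
    proof (rule nn_integral_mono_AE, use AEs in eventually_elim)
      fix x assume "summable (\<lambda>n. \<bar>f n x\<bar>)"
      then have "(\<lambda>N. (g N x)\<^sup>2) \<longlonglongrightarrow> (G x)\<^sup>2"
        unfolding g_def G_def by (intro tendsto_power summable_LIMSEQ)
      then have "(\<lambda>N. ennreal ((g N x)\<^sup>2)) \<longlonglongrightarrow> ennreal ((G x)\<^sup>2)"
        by (intro tendsto_ennrealI)
      moreover have "(\<lambda>N. ennreal ((g N x)\<^sup>2)) \<longlonglongrightarrow> (SUP N. ennreal ((g N x)\<^sup>2))"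
        using gmono by (intro LIMSEQ_SUP) (auto simp: incseq_def mono_def intro!: ennreal_leI)
      ultimately have "ennreal ((G x)\<^sup>2) = (SUP N. ennreal ((g N x)\<^sup>2))"
        by (rule LIMSEQ_unique)
      then show "ennreal (norm ((G x)\<^sup>2)) \<le> (SUP N. ennreal ((g N x)\<^sup>2))" by simp
    qed
    then show "(\<integral>\<^sup>+x. norm ((G x)\<^sup>2) \<partial>half_gaussian) < \<infinity>"
      using fin by (simp add: less_top[symmetric] top_unique) (metis neq_top_trans)
  qed simp
  define F where "F x = (\<Sum>n. f n x)" for x
  have [measurable]: "F \<in> borel_measurable half_gaussian"
    unfolding F_def[abs_def] by measurable
  have FG: "\<bar>F x - (\<Sum>n<N. f n x)\<bar> \<le> G x" if x: "summable (\<lambda>n. \<bar>f n x\<bar>)" for x N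
  proof -
    have s: "summable (\<lambda>n. f n x)" by (rule summable_rabs_cancel[OF x])
    have "F x - (\<Sum>n<N. f n x) = (\<Sum>n. f (n + N) x)"
      unfolding F_def using suminf_split_initial_segment[OF s, of N] by simp
    also have "\<bar>\<dots>\<bar> \<le> (\<Sum>n. \<bar>f (n + N) x\<bar>)"
      by (rule summable_rabs) (use x in \<open>simp add: summable_iff_shift[of "\<lambda>n. \<bar>f n x\<bar>"]\<close>)
    also have "\<dots> \<le> G x"
      unfolding G_def using suminf_split_initial_segment[OF x, of N] by (simp add: sum_nonneg)
    finally show ?thesis .
  qed
  \<comment> \<open>The case \<open>N = 0\<close> gives square integrability of \<open>F\<close>;
    the general case supplies the dominating function for the remainders.\<close>
  have bound: "AE x in half_gaussian. norm ((F x - (\<Sum>n<N. f n x))\<^sup>2) \<le> (G x)\<^sup>2" for N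
    using AEs
  proof eventually_elim
    fix x assume "summable (\<lambda>n. \<bar>f n x\<bar>)"
    then show "norm ((F x - (\<Sum>n<N. f n x))\<^sup>2) \<le> (G x)\<^sup>2"
      using power_mono[OF FG abs_ge_zero, of x N 2] by simp
  qed
  have FL2: "F \<in> L2 half_gaussian"
    unfolding L2_def
  proof (intro CollectI conjI)
    show "integrable half_gaussian (\<lambda>x. (F x)\<^sup>2)"
      by (rule Bochner_Integration.integrable_bound[OF Gint]) (use bound[of 0] in simp_all)
  qed simp
  then show "(\<lambda>x. \<Sum>n. f n x) \<in> L2 half_gaussian" by (simp add: F_def[abs_def])
  have "(\<lambda>N. LINT x|half_gaussian. (F x - (\<Sum>n<N. f n x))\<^sup>2) \<longlonglongrightarrow> (LINT x|half_gaussian. 0)"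
  proof (rule integral_dominated_convergence[where w = "\<lambda>x. (G x)\<^sup>2"])
    show "AE x in half_gaussian. norm ((F x - (\<Sum>n<N. f n x))\<^sup>2) \<le> (G x)\<^sup>2" for N
      by (rule bound)
    show "AE x in half_gaussian. (\<lambda>N. (F x - (\<Sum>n<N. f n x))\<^sup>2) \<longlonglongrightarrow> 0"
      using AEs
    proof eventually_elim
      fix x assume "summable (\<lambda>n. \<bar>f n x\<bar>)"
      then have "(\<lambda>N. \<Sum>n<N. f n x) \<longlonglongrightarrow> F x"
        unfolding F_def by (rule summable_LIMSEQ[OF summable_rabs_cancel])
      then have "(\<lambda>N. (F x - (\<Sum>n<N. f n x))\<^sup>2) \<longlonglongrightarrow> (F x - F x)\<^sup>2"
        by (rule tendsto_power[OF tendsto_diff[OF tendsto_const]])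
      then show "(\<lambda>N. (F x - (\<Sum>n<N. f n x))\<^sup>2) \<longlonglongrightarrow> 0" by simp
    qed
  qed (simp_all add: Gint)
  moreover have "(LINT x|half_gaussian. (F x - (\<Sum>n<N. f n x))\<^sup>2) = (norm (abs_hilb F - (\<Sum>n<N. abs_hilb (f n))))\<^sup>2" for N
    by (simp add: sum_abs_hilb f diff_abs_hilb FL2 L2_sum norm_abs_hilb_sq L2_diff)
  ultimately have "(\<lambda>N. (norm (abs_hilb F - (\<Sum>n<N. abs_hilb (f n))))\<^sup>2) \<longlonglongrightarrow> 0"
    by simp
  then have "(\<lambda>N. sqrt ((norm (abs_hilb F - (\<Sum>n<N. abs_hilb (f n))))\<^sup>2)) \<longlonglongrightarrow> sqrt 0"
    by (rule tendsto_real_sqrt)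
  then have "(\<lambda>N. norm ((\<Sum>n<N. abs_hilb (f n)) - abs_hilb F)) \<longlonglongrightarrow> 0"
    by (simp add: norm_minus_commute)
  then show "(\<lambda>n. abs_hilb (f n)) sums abs_hilb (\<lambda>x. \<Sum>n. f n x)"
    unfolding sums_def F_def[abs_def, symmetric]
    by (rule LIM_zero_cancel[OF tendsto_norm_zero_cancel])
qed

instance hilb :: banach
proof
  fix X :: "nat \<Rightarrow> hilb" assume X: "Cauchy X"
  show "convergent X"
  proof (rule convergent_if_absolutely_summable[OF _ X])
    fix f :: "nat \<Rightarrow> hilb" assume "summable (\<lambda>n. norm (f n))"
    then have "(\<lambda>n. abs_hilb (rep_hilb (f n))) sums abs_hilb (\<lambda>x. \<Sum>n. rep_hilb (f n) x)"
      by (intro abs_hilb_sums L2_rep_hilb) simp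
    then show "summable f" by (simp add: sums_iff)
  qed
qed

section \<open>Hermite polynomials and Mehler's formula\<close>

text \<open>The probabilists' Hermite polynomials, over any commutative ring because they occur with
  real and with complex arguments.\<close>

fun hermite :: "nat \<Rightarrow> 'a::comm_ring_1 \<Rightarrow> 'a" where
  "hermite 0 x = 1"
| "hermite (Suc 0) x = x"
| "hermite (Suc (Suc n)) x = x * hermite (Suc n) x - of_nat (Suc n) * hermite n x"

lemma of_real_hermite:
  "(of_real (hermite n x) :: 'a::{comm_ring_1, real_algebra_1}) = hermite n (of_real x)"
  by (induction n x rule: hermite.induct) simp_all

definition mehler_coeff :: "nat \<Rightarrow> complex \<Rightarrow> complex \<Rightarrow> complex" where
  "mehler_coeff n x y = hermite n x * hermite n y / fact n"

text \<open>
  The coefficient form of the differential equation that \<open>mehler_kernel_has_derivative\<close> states for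
  the kernel as a function of \<open>\<rho>\<close>.
\<close>

lemma mehler_coeff_rec:
  "of_nat (n + 4) * mehler_coeff (n + 4) x y =
    (of_nat (2 * n + 5) - x\<^sup>2 - y\<^sup>2) * mehler_coeff (n + 2) x y
    + x * y * (mehler_coeff (n + 3) x y + mehler_coeff (n + 1) x y)
    - of_nat (n + 1) * mehler_coeff n x y"
proof -
  define N p0 p1 q0 q1 where "N = (of_nat n :: complex)" and "p0 = hermite n x" and "p1 = hermite (Suc n) x"
    and "q0 = hermite n y" and "q1 = hermite (Suc n) y"
  define p2 p3 q2 q3 where "p2 = x * p1 - (N + 1) * p0" and "p3 = x * p2 - (N + 2) * p1"
    and "q2 = y * q1 - (N + 1) * q0" and "q3 = y * q2 - (N + 2) * q1"
  have p: "hermite n x = p0" "hermite (n + 1) x = p1" "hermite (n + 2) x = p2" "hermite (n + 3) x = p3"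
    "hermite (n + 4) x = x * p3 - (N + 3) * p2"
    by (simp_all add: p0_def p1_def p2_def p3_def N_def eval_nat_numeral add_ac)
  have q: "hermite n y = q0" "hermite (n + 1) y = q1" "hermite (n + 2) y = q2" "hermite (n + 3) y = q3"
    "hermite (n + 4) y = y * q3 - (N + 3) * q2"
    by (simp_all add: q0_def q1_def q2_def q3_def N_def eval_nat_numeral add_ac)
  have N: "N + 1 \<noteq> 0" "N + 2 \<noteq> 0" "N + 3 \<noteq> 0" "N + 4 \<noteq> 0"
    unfolding N_def using of_nat_neq_0[of n, where 'a = complex] of_nat_neq_0[of "n + 1", where 'a = complex]
      of_nat_neq_0[of "n + 2", where 'a = complex] of_nat_neq_0[of "n + 3", where 'a = complex]
    by (simp_all add: algebra_simps)
  define f where "f = (fact n :: complex)"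
  have f0: "f \<noteq> 0" by (simp add: f_def)
  have f: "fact n = f" "fact (n + 1) = f * (N + 1)" "fact (n + 2) = f * (N + 1) * (N + 2)"
    "fact (n + 3) = f * (N + 1) * (N + 2) * (N + 3)"
    "fact (n + 4) = f * (N + 1) * (N + 2) * (N + 3) * (N + 4)"
    by (simp_all add: f_def N_def eval_nat_numeral algebra_simps)
  \<comment> \<open>The claim multiplied by \<open>f * (N + 1) * (N + 2) * (N + 3)\<close>.
    Substituting \<open>p2\<close>, \<open>p3\<close>, \<open>q2\<close> and \<open>q3\<close> makes
    it a polynomial identity.\<close>
  have key: "(x * p3 - (N + 3) * p2) * (y * q3 - (N + 3) * q2) =
      (2 * N + 5 - x\<^sup>2 - y\<^sup>2) * (N + 3) * (p2 * q2)
      + x * y * (p3 * q3 + (N + 2) * (N + 3) * (p1 * q1))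
      - (N + 1)\<^sup>2 * (N + 2) * (N + 3) * (p0 * q0)"
    unfolding p3_def q3_def p2_def q2_def by (simp add: power2_eq_square algebra_simps)
  have n: "of_nat (n + 4) = N + 4" "of_nat (2 * n + 5) = 2 * N + 5" "of_nat (n + 1) = N + 1"
    by (simp_all add: N_def)
  have c1: "c \<noteq> 0 \<Longrightarrow> c * (P / (B * c)) = P / B" for P B c :: complex
    by simp
  have c2: "c \<noteq> 0 \<Longrightarrow> T * c * P / (B * c) = T * (P / B)" for T P B c :: complex
    by simp
  have c3: "d \<noteq> 0 \<Longrightarrow> a \<noteq> 0 \<Longrightarrow> b \<noteq> 0 \<Longrightarrow> c \<noteq> 0 \<Longrightarrow>
      T * (P + b * c * S) / (d * a * b * c) = T * (P / (d * a * b * c) + S / (d * a))" for T P S a b c d :: complex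
    by (simp add: field_simps)
  have c4: "a \<noteq> 0 \<Longrightarrow> b \<noteq> 0 \<Longrightarrow> c \<noteq> 0 \<Longrightarrow> a\<^sup>2 * b * c * P / (d * a * b * c) = a * (P / d)" for P a b c d :: complex
    by (simp add: power2_eq_square)
  have "(N + 4) * ((x * p3 - (N + 3) * p2) * (y * q3 - (N + 3) * q2) / (f * (N + 1) * (N + 2) * (N + 3) * (N + 4)))
     = ((x * p3 - (N + 3) * p2) * (y * q3 - (N + 3) * q2)) / (f * (N + 1) * (N + 2) * (N + 3))"
    by (rule c1[OF N(4)])
  also have "\<dots> = (2 * N + 5 - x\<^sup>2 - y\<^sup>2) * (N + 3) * (p2 * q2) / (f * (N + 1) * (N + 2) * (N + 3))
      + x * y * (p3 * q3 + (N + 2) * (N + 3) * (p1 * q1)) / (f * (N + 1) * (N + 2) * (N + 3))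
      - (N + 1)\<^sup>2 * (N + 2) * (N + 3) * (p0 * q0) / (f * (N + 1) * (N + 2) * (N + 3))"
    unfolding key diff_divide_distrib add_divide_distrib ..
  also have "(2 * N + 5 - x\<^sup>2 - y\<^sup>2) * (N + 3) * (p2 * q2) / (f * (N + 1) * (N + 2) * (N + 3))
     = (2 * N + 5 - x\<^sup>2 - y\<^sup>2) * (p2 * q2 / (f * (N + 1) * (N + 2)))"
    by (rule c2[OF N(3)])
  also have "x * y * (p3 * q3 + (N + 2) * (N + 3) * (p1 * q1)) / (f * (N + 1) * (N + 2) * (N + 3))
     = x * y * (p3 * q3 / (f * (N + 1) * (N + 2) * (N + 3)) + p1 * q1 / (f * (N + 1)))"
    by (rule c3[OF f0 N(1-3)])
  also have "(N + 1)\<^sup>2 * (N + 2) * (N + 3) * (p0 * q0) / (f * (N + 1) * (N + 2) * (N + 3))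
     = (N + 1) * (p0 * q0 / f)"
    by (rule c4[OF N(1-3)])
  finally show ?thesis
    unfolding mehler_coeff_def p q f n .
qed

section \<open>The Mehler kernel and its Taylor series\<close>

text \<open>\<open>m_kernel\<close> continued to complex arguments. On the unit disc
  \<open>1 - \<rho>\<^sup>2\<close> has positive real part, so the principal root is holomorphic
  there.\<close>

definition mehler_kernel :: "complex \<Rightarrow> complex \<Rightarrow> complex \<Rightarrow> complex" where
  "mehler_kernel x y \<rho> = exp ((2 * \<rho> * x * y - \<rho>\<^sup>2 * (x\<^sup>2 + y\<^sup>2)) / (2 * (1 - \<rho>\<^sup>2))) / csqrt (1 - \<rho>\<^sup>2)"

lemma one_minus_sq_slit:
  assumes "cmod \<rho> < 1"
  shows "1 - \<rho>\<^sup>2 \<notin> \<real>\<^sub>\<le>\<^sub>0" and "1 - \<rho>\<^sup>2 \<noteq> 0"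
proof -
  have "cmod (\<rho>\<^sup>2) < 1" using assms by (simp add: norm_power power_less_one_iff)
  then have "Re (1 - \<rho>\<^sup>2) > 0" using complex_Re_le_cmod[of "\<rho>\<^sup>2"] by simp
  then show "1 - \<rho>\<^sup>2 \<notin> \<real>\<^sub>\<le>\<^sub>0" and "1 - \<rho>\<^sup>2 \<noteq> 0"
    by (auto simp: complex_nonpos_Reals_iff simp del: minus_complex.sel)
qed

text \<open>The logarithmic derivative is rational in \<rho>; clearing its denominator leaves a
  linear differential equation with polynomial coefficients.\<close>

lemma mehler_kernel_has_derivative:
  assumes "cmod \<rho> < 1"
  shows "(mehler_kernel x y has_field_derivative
     (\<rho> * (1 - \<rho>\<^sup>2) + x * y * (1 + \<rho>\<^sup>2) - \<rho> * (x\<^sup>2 + y\<^sup>2)) / (1 - \<rho>\<^sup>2)\<^sup>2 * mehler_kernel x y \<rho>) (at \<rho>)"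
proof -
  note nz = one_minus_sq_slit[OF assms]
  define u where "u = 1 - \<rho>\<^sup>2"
  define E where "E \<rho> = (2 * \<rho> * x * y - \<rho>\<^sup>2 * (x\<^sup>2 + y\<^sup>2)) / (2 * (1 - \<rho>\<^sup>2))" for \<rho>
  have u: "u \<noteq> 0" "csqrt u \<noteq> 0" using nz by (auto simp: u_def)
  have E: "(E has_field_derivative (x * y * (1 + \<rho>\<^sup>2) - \<rho> * (x\<^sup>2 + y\<^sup>2)) / u\<^sup>2) (at \<rho>)"
  proof -
    have *: "((2 * x * y - 2 * \<rho> * (x\<^sup>2 + y\<^sup>2)) * (2 * u) - (2 * \<rho> * x * y - \<rho>\<^sup>2 * (x\<^sup>2 + y\<^sup>2)) * (- 4 * \<rho>)) / (2 * u)\<^sup>2 =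
        (x * y * (1 + \<rho>\<^sup>2) - \<rho> * (x\<^sup>2 + y\<^sup>2)) / u\<^sup>2"
      using u(1) by (simp add: divide_simps) (simp add: u_def power2_eq_square algebra_simps)
    show ?thesis
      unfolding E_def[abs_def] *[symmetric]
      by (rule derivative_eq_intros refl | use nz in \<open>simp add: u_def power2_eq_square\<close>)+
  qed
  have S: "((\<lambda>\<rho>. csqrt (1 - \<rho>\<^sup>2)) has_field_derivative - \<rho> / csqrt u) (at \<rho>)"
    by (rule derivative_eq_intros refl | use nz in \<open>simp add: u_def\<close>)+
  have "((\<lambda>\<rho>. exp (E \<rho>) / csqrt (1 - \<rho>\<^sup>2)) has_field_derivative
     (exp (E \<rho>) * ((x * y * (1 + \<rho>\<^sup>2) - \<rho> * (x\<^sup>2 + y\<^sup>2)) / u\<^sup>2) * csqrt u - exp (E \<rho>) * (- \<rho> / csqrt u)) / (csqrt u * csqrt u)) (at \<rho>)"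
    unfolding u_def
    by (rule DERIV_divide[OF DERIV_fun_exp[OF E[unfolded u_def]] S[unfolded u_def] u(2)[unfolded u_def]])
  also have "csqrt u * csqrt u = u"
    by (simp flip: power2_eq_square)
  also have "exp (E \<rho>) * (- \<rho> / csqrt u) = - (exp (E \<rho>) * (\<rho> / u) * csqrt u)"
  proof -
    have "\<rho> / csqrt u = \<rho> / u * csqrt u"
      using u by (simp add: divide_simps) (simp flip: power2_eq_square)
    then show ?thesis by simp
  qed
  also have "(exp (E \<rho>) * ((x * y * (1 + \<rho>\<^sup>2) - \<rho> * (x\<^sup>2 + y\<^sup>2)) / u\<^sup>2) * csqrt u - - (exp (E \<rho>) * (\<rho> / u) * csqrt u)) / u
      = (\<rho> * u + x * y * (1 + \<rho>\<^sup>2) - \<rho> * (x\<^sup>2 + y\<^sup>2)) / u\<^sup>2 * (exp (E \<rho>) * (csqrt u / u))"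
    using u(1) by (simp add: divide_simps) (simp add: power2_eq_square algebra_simps)
  also have "csqrt u / u = 1 / csqrt u"
    using u by (simp add: divide_simps) (simp flip: power2_eq_square)
  finally show ?thesis
    unfolding mehler_kernel_def[abs_def] E_def u_def by simp
qed

lemma holomorphic_mehler_kernel: "mehler_kernel x y holomorphic_on ball 0 1"
proof -
  have "\<exists>D. (mehler_kernel x y has_field_derivative D) (at \<rho>)" if "\<rho> \<in> ball 0 1" for \<rho>
    using mehler_kernel_has_derivative[of \<rho> x y] that by (intro exI) simp
  then show ?thesis by (simp add: holomorphic_on_open)
qed

text \<open>The Taylor series converges because the kernel is holomorphic on the unit disc. The
  differential equation and the value 1 at 0 determine its coefficients, and
  \<open>mehler_coeff\<close> obeys the same recurrence.\<close>

lemma mehler_kernel_sums: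
  assumes \<rho>: "cmod \<rho> < 1"
  shows "(\<lambda>n. mehler_coeff n x y * \<rho> ^ n) sums mehler_kernel x y \<rho>"
proof -
  define K where "K = mehler_kernel x y"
  define F where "F = fps_expansion K 0"
  define f where "f n = fps_nth F n" for n
  have F: "K has_fps_expansion F"
    unfolding F_def K_def by (rule has_fps_expansion_fps_expansion[OF _ _ holomorphic_mehler_kernel]) auto
  define Q :: "complex fps" where
    "Q = fps_X * (1 - fps_X ^ 2) + fps_const (x * y) * (1 + fps_X ^ 2) - fps_X * fps_const (x\<^sup>2 + y\<^sup>2)"
  have L: "(\<lambda>\<rho>. (1 - \<rho>\<^sup>2)\<^sup>2 * deriv K \<rho>) has_fps_expansion (1 - fps_X ^ 2) ^ 2 * fps_deriv F"
    by (intro fps_expansion_intros F)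
  have R: "(\<lambda>\<rho>. (\<rho> * (1 - \<rho>\<^sup>2) + x * y * (1 + \<rho>\<^sup>2) - \<rho> * (x\<^sup>2 + y\<^sup>2)) * K \<rho>) has_fps_expansion Q * F"
    unfolding Q_def by (intro fps_expansion_intros F)
  have "eventually (\<lambda>\<rho>. \<rho> \<in> ball 0 1) (nhds (0::complex))"
    by (intro eventually_nhds_in_open) auto
  then have ev: "eventually (\<lambda>\<rho>. (1 - \<rho>\<^sup>2)\<^sup>2 * deriv K \<rho> = (\<rho> * (1 - \<rho>\<^sup>2) + x * y * (1 + \<rho>\<^sup>2) - \<rho> * (x\<^sup>2 + y\<^sup>2)) * K \<rho>) (nhds 0)"
  proof eventually_elim
    fix \<rho> :: complex assume "\<rho> \<in> ball 0 1"
    then have \<rho>: "cmod \<rho> < 1" by simp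
    show "(1 - \<rho>\<^sup>2)\<^sup>2 * deriv K \<rho> = (\<rho> * (1 - \<rho>\<^sup>2) + x * y * (1 + \<rho>\<^sup>2) - \<rho> * (x\<^sup>2 + y\<^sup>2)) * K \<rho>"
      using one_minus_sq_slit(2)[OF \<rho>]
      unfolding K_def DERIV_imp_deriv[OF mehler_kernel_has_derivative[OF \<rho>]] by simp
  qed
  have "(\<lambda>\<rho>. (1 - \<rho>\<^sup>2)\<^sup>2 * deriv K \<rho>) has_fps_expansion Q * F"
    using R has_fps_expansion_cong[OF ev refl] by blast
  then have eq: "(1 - fps_X ^ 2) ^ 2 * fps_deriv F = Q * F"
    by (rule fps_expansion_unique_complex[OF L])
  have lhs: "(1 - fps_X ^ 2) ^ 2 * fps_deriv F = fps_deriv F - 2 * (fps_X ^ 2 * fps_deriv F) + fps_X ^ 4 * fps_deriv F"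
    by (simp add: power2_eq_square algebra_simps numeral_eq_Suc)
  have rhs: "Q * F = fps_X * F - fps_X ^ 3 * F + fps_const (x * y) * F + fps_const (x * y) * (fps_X ^ 2 * F)
      - fps_const (x\<^sup>2 + y\<^sup>2) * (fps_X * F)"
    unfolding Q_def by (simp add: algebra_simps numeral_eq_Suc)
  have rec: "fps_deriv F = 2 * (fps_X ^ 2 * fps_deriv F) - fps_X ^ 4 * fps_deriv F
      + fps_X * F - fps_X ^ 3 * F + fps_const (x * y) * F + fps_const (x * y) * (fps_X ^ 2 * F)
      - fps_const (x\<^sup>2 + y\<^sup>2) * (fps_X * F)"
    using eq unfolding lhs rhs by (simp add: algebra_simps)
  \<comment> \<open>Multiplication by a power of \<open>fps_X\<close> shifts the index; the
    conditionals stand for coefficients of negative index.\<close>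
  have nth: "of_nat (Suc n) * f (Suc n) = 2 * (if n < 2 then 0 else of_nat (Suc (n - 2)) * f (Suc (n - 2)))
      - (if n < 4 then 0 else of_nat (Suc (n - 4)) * f (Suc (n - 4)))
      + (if n = 0 then 0 else f (n - 1)) - (if n < 3 then 0 else f (n - 3)) + x * y * f n
      + x * y * (if n < 2 then 0 else f (n - 2)) - (x\<^sup>2 + y\<^sup>2) * (if n = 0 then 0 else f (n - 1))" for n
  proof -
    have two: "fps_nth (2 * G) n = 2 * fps_nth G n" for G :: "complex fps"
      unfolding numeral_fps_const by (rule fps_mult_left_const_nth)
    have "of_nat (Suc n) * f (Suc n) = fps_nth (fps_deriv F) n"
      by (simp add: f_def)
    also have "\<dots> = fps_nth (2 * (fps_X ^ 2 * fps_deriv F) - fps_X ^ 4 * fps_deriv F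
      + fps_X * F - fps_X ^ 3 * F + fps_const (x * y) * F + fps_const (x * y) * (fps_X ^ 2 * F)
      - fps_const (x\<^sup>2 + y\<^sup>2) * (fps_X * F)) n"
      by (rule arg_cong[OF rec])
    finally show ?thesis
      by (simp only: f_def two fps_X_power_mult_nth fps_X_mult_nth fps_mult_left_const_nth
          fps_add_nth fps_sub_nth fps_deriv_nth Suc_eq_plus1)
  qed
  have coeff: "f n = mehler_coeff n x y" for n
  proof (induction n rule: less_induct)
    case (less n)
    have c0: "f 0 = 1"
      using has_fps_expansion_imp_0_eq_fps_nth_0[OF F] by (simp add: f_def K_def mehler_kernel_def)
    \<comment> \<open>The recurrence reaches back four places, so the first four coefficients are
      computed directly.\<close>
    consider "n = 0" | "n = 1" | "n = 2" | "n = 3" | m where "n = m + 4"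
    proof -
      have "n = 0 \<or> n = 1 \<or> n = 2 \<or> n = 3 \<or> n = (n - 4) + 4" by arith
      then show ?thesis using that by blast
    qed
    then show ?case
    proof cases
      case 1
      then show ?thesis by (simp add: c0 mehler_coeff_def)
    next
      case 2
      then show ?thesis using nth[of 0] by (simp add: c0 mehler_coeff_def)
    next
      case 3
      then show ?thesis using nth[of 1] nth[of 0]
        by (simp add: c0 mehler_coeff_def numeral_2_eq_2 field_simps power2_eq_square)
    next
      case 4
      have f1: "f 1 = x * y" using nth[of 0] by (simp add: c0)
      have f2: "2 * f 2 = 1 + x * y * f 1 + x * y * 0 - (x\<^sup>2 + y\<^sup>2)"
        using nth[of 1] by (simp add: c0 numeral_2_eq_2)
      have f3: "3 * f 3 = 2 * f 1 + f 1 + x * y * f 2 + x * y - (x\<^sup>2 + y\<^sup>2) * f 1"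
        using nth[of 2] by (simp add: c0 eval_nat_numeral)
      have "6 * f 3 = (x ^ 3 - 3 * x) * (y ^ 3 - 3 * y)"
        using f1 f2 f3 by algebra
      moreover have "hermite 3 z = z ^ 3 - 3 * z" for z :: complex
        by (simp add: eval_nat_numeral algebra_simps)
      ultimately have "6 * f 3 = 6 * mehler_coeff 3 x y"
        by (simp add: mehler_coeff_def fact_numeral)
      then show ?thesis using 4 by simp
    next
      case (5 m)
      have IH: "f (m + 3) = mehler_coeff (m + 3) x y" "f (m + 2) = mehler_coeff (m + 2) x y"
        "f (m + 1) = mehler_coeff (m + 1) x y" "f m = mehler_coeff m x y"
        using 5 by (auto intro!: less)
      have n: "Suc (m + 3) = m + 4" "Suc (m + 1) = m + 2" "m + 3 - 2 = m + 1" "m + 3 - 1 = m + 2"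
        "m + 3 - 3 = m" "(m + 3 < 2) = False" "(m + 3 < 3) = False" "(m + 3 = 0) = False"
        by auto
      \<comment> \<open>For \<open>m = 0\<close> the conditional yields 0, in agreement with the
        factor \<open>of_nat m\<close>.\<close>
      have last: "(if m + 3 < 4 then 0 else of_nat (Suc (m + 3 - 4)) * f (Suc (m + 3 - 4))) = of_nat m * f m"
        by (cases m) auto
      have "of_nat (m + 4) * f (m + 4) = 2 * (of_nat (m + 2) * f (m + 2)) - of_nat m * f m
          + f (m + 2) - f m + x * y * f (m + 3) + x * y * f (m + 1) - (x\<^sup>2 + y\<^sup>2) * f (m + 2)"
        using nth[of "m + 3"] unfolding last n if_False .
      also have "\<dots> = (of_nat (2 * m + 5) - x\<^sup>2 - y\<^sup>2) * f (m + 2)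
          + x * y * (f (m + 3) + f (m + 1)) - of_nat (m + 1) * f m"
        by (simp add: algebra_simps)
      finally have "of_nat (m + 4) * f (m + 4) = \<dots>" .
      then have "of_nat (m + 4) * f (m + 4) = of_nat (m + 4) * mehler_coeff (m + 4) x y"
        unfolding IH mehler_coeff_rec .
      moreover have "of_nat (m + 4) \<noteq> (0 :: complex)"
        using of_nat_neq_0[of "m + 3", where 'a = complex] by (simp add: algebra_simps)
      ultimately show ?thesis using 5 by simp
    qed
  qed
  have "(\<lambda>n. (deriv ^^ n) K 0 / fact n * (\<rho> - 0) ^ n) sums K \<rho>"
    unfolding K_def using \<rho> by (intro holomorphic_power_series[OF holomorphic_mehler_kernel]) auto
  moreover have c: "(deriv ^^ n) K 0 / fact n = mehler_coeff n x y" for n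
    unfolding coeff[symmetric] f_def F_def fps_expansion_def by simp
  ultimately show ?thesis unfolding c diff_zero by (simp only: K_def)
qed

section \<open>Normalised Hermite polynomials and the real Mehler formula\<close>

definition hermite_fun :: "nat \<Rightarrow> real \<Rightarrow> real" where
  "hermite_fun n x = hermite n x / sqrt (fact n)"

lemma hermite_measurable [measurable]: "hermite n \<in> borel_measurable (borel :: real measure)"
proof (induction n rule: less_induct)
  case (less n)
  consider "n = 0" | "n = 1" | m where "n = Suc (Suc m)"
  proof -
    have "n = 0 \<or> n = 1 \<or> n = Suc (Suc (n - 2))" by arith
    then show ?thesis using that by blast
  qed
  then show ?case
  proof cases
    case (3 m)
    have [measurable]: "hermite m \<in> borel_measurable (borel :: real measure)"
      "hermite (Suc m) \<in> borel_measurable (borel :: real measure)"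
      using less 3 by auto
    have "hermite (Suc (Suc m)) = (\<lambda>x :: real. x * hermite (Suc m) x - of_nat (Suc m) * hermite m x)"
      by (simp add: fun_eq_iff)
    also have "\<dots> \<in> borel_measurable borel" by measurable
    finally show ?thesis using 3 by simp
  qed (simp_all add: hermite.simps[abs_def])
qed

lemma hermite_fun_measurable [measurable]: "hermite_fun n \<in> borel_measurable borel"
  unfolding hermite_fun_def[abs_def] by measurable

lemma mehler:
  assumes "\<bar>\<rho>\<bar> < 1"
  shows "(\<lambda>n. \<rho> ^ n * hermite_fun n x * hermite_fun n y) sums m_kernel \<rho> x y"
proof -
  have "\<rho>\<^sup>2 < 1" using assms by (simp add: abs_square_less_1)
  then have sq: "csqrt (1 - (complex_of_real \<rho>)\<^sup>2) = of_real (sqrt (1 - \<rho>\<^sup>2))"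
    by (subst of_real_sqrt) simp_all
  have "(\<lambda>n. Re (mehler_coeff n (of_real x) (of_real y) * of_real \<rho> ^ n)) sums
      Re (mehler_kernel (of_real x) (of_real y) (of_real \<rho>))"
    using assms by (intro sums_Re mehler_kernel_sums) simp
  also have "(\<lambda>n. Re (mehler_coeff n (of_real x) (of_real y) * of_real \<rho> ^ n)) =
      (\<lambda>n. \<rho> ^ n * hermite_fun n x * hermite_fun n y)"
  proof
    fix n
    have "mehler_coeff n (of_real x) (of_real y) * of_real \<rho> ^ n =
        complex_of_real (hermite n x * hermite n y / fact n * \<rho> ^ n)"
      by (simp add: mehler_coeff_def of_real_hermite)
    then have "Re (mehler_coeff n (of_real x) (of_real y) * of_real \<rho> ^ n) =
        hermite n x * hermite n y / fact n * \<rho> ^ n"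
      by (simp only: Re_complex_of_real)
    then show "Re (mehler_coeff n (of_real x) (of_real y) * of_real \<rho> ^ n) =
        \<rho> ^ n * hermite_fun n x * hermite_fun n y"
      by (simp add: hermite_fun_def)
  qed
  also have "Re (mehler_kernel (of_real x) (of_real y) (of_real \<rho>)) = m_kernel \<rho> x y"
  proof -
    have "mehler_kernel (of_real x) (of_real y) (of_real \<rho>) =
       complex_of_real (exp ((2 * \<rho> * x * y - \<rho>\<^sup>2 * (x\<^sup>2 + y\<^sup>2)) / (2 * (1 - \<rho>\<^sup>2))) / sqrt (1 - \<rho>\<^sup>2))"
      unfolding mehler_kernel_def sq by (simp flip: exp_of_real)
    then have "Re (mehler_kernel (of_real x) (of_real y) (of_real \<rho>)) =
       exp ((2 * \<rho> * x * y - \<rho>\<^sup>2 * (x\<^sup>2 + y\<^sup>2)) / (2 * (1 - \<rho>\<^sup>2))) / sqrt (1 - \<rho>\<^sup>2)"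
      by (simp only: Re_complex_of_real)
    moreover have "(2 * \<rho> * x * y - \<rho>\<^sup>2 * (x\<^sup>2 + y\<^sup>2)) / (2 * (1 - \<rho>\<^sup>2)) =
        - ((\<rho>\<^sup>2 * x\<^sup>2 + \<rho>\<^sup>2 * y\<^sup>2 - 2 * \<rho> * x * y) / (2 * (1 - \<rho>\<^sup>2)))"
      unfolding minus_divide_left by (simp add: algebra_simps)
    ultimately show ?thesis by (simp add: m_kernel_def)
  qed
  finally show ?thesis .
qed

section \<open>The integral operator\<close>

lemma sets_gaussian: "sets gaussian = sets borel" "space gaussian = UNIV"
  by (simp_all add: gaussian_def)

lemma measurable_half_gaussian [measurable (raw)]:
  "f \<in> borel_measurable borel \<Longrightarrow> f \<in> borel_measurable half_gaussian"
  unfolding half_gaussian_def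
  by (rule measurable_restrict_space1) (simp add: gaussian_def)

text \<open>Together with the density the exponent is \<open>- a * x\<^sup>2\<close> for
  \<open>a = 1 / 2 - c\<close>. Scaling by \<open>sqrt a\<close>, which preserves the half line,
  reduces the claim to the Gaussian integral.\<close>

lemma has_integral_half_gaussian_exp:
  assumes c: "c < 1 / 2"
  shows "has_bochner_integral half_gaussian (\<lambda>x. exp (c * x\<^sup>2)) (1 / (2 * sqrt (1 - 2 * c)))"
proof -
  define a where "a = 1 / 2 - c"
  have a: "a > 0" using c by (simp add: a_def)
  have ind: "indicator {0..} (sqrt a * x) = (indicator {0..} x :: real)" for x
    using a by (auto simp: indicator_def zero_le_mult_iff)
  have val: "(sqrt pi / 2) /\<^sub>R \<bar>sqrt a\<bar> = sqrt pi / (2 * sqrt a)"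
    using a by (simp add: field_simps)
  have "has_bochner_integral lborel (\<lambda>x. indicator {0..} (0 + sqrt a * x) *\<^sub>R exp (- (0 + sqrt a * x)\<^sup>2))
      ((sqrt pi / 2) /\<^sub>R \<bar>sqrt a\<bar>)"
    using gaussian_moment_0 a
    by (subst lborel_has_bochner_integral_real_affine_iff[symmetric]) auto
  then have "has_bochner_integral lborel (\<lambda>x. indicator {0..} x *\<^sub>R exp (- (a * x\<^sup>2))) (sqrt pi / (2 * sqrt a))"
    by (simp only: val ind add_0_left power_mult_distrib real_sqrt_pow2[OF less_imp_le[OF a]])
  then have "has_bochner_integral lborel (\<lambda>x. (1 / sqrt (2 * pi)) * (indicator {0..} x *\<^sub>R exp (- (a * x\<^sup>2))))
      ((1 / sqrt (2 * pi)) * (sqrt pi / (2 * sqrt a)))"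
    by (rule has_bochner_integral_mult_right)
  also have "(\<lambda>x. (1 / sqrt (2 * pi)) * (indicator {0..} x *\<^sub>R exp (- (a * x\<^sup>2)))) =
      (\<lambda>x. std_normal_density x *\<^sub>R (indicator {0..} x *\<^sub>R exp (c * x\<^sup>2)))"
  proof -
    have "exp (- (a * x\<^sup>2)) = exp (- x\<^sup>2 / 2) * exp (c * x\<^sup>2)" for x
      unfolding exp_add[symmetric] by (simp add: a_def algebra_simps)
    then show ?thesis by (simp add: fun_eq_iff std_normal_density_def)
  qed
  also have "(1 / sqrt (2 * pi)) * (sqrt pi / (2 * sqrt a)) = 1 / (2 * sqrt (1 - 2 * c))"
  proof -
    have "1 - 2 * c = 2 * a" by (simp add: a_def)
    then show ?thesis by (simp add: real_sqrt_mult)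
  qed
  finally have "has_bochner_integral gaussian (\<lambda>x. indicator {0..} x *\<^sub>R exp (c * x\<^sup>2)) (1 / (2 * sqrt (1 - 2 * c)))"
    unfolding gaussian_def by (intro has_bochner_integral_density) auto
  then show ?thesis
    unfolding half_gaussian_def
    by (subst has_bochner_integral_restrict_space) (auto simp: sets_gaussian)
qed

section \<open>The diagonal of the kernel and the norms of the Hermite polynomials\<close>

text \<open>On the diagonal the exponent collapses to
  \<open>\<rho> / (1 + \<rho>) * x\<^sup>2\<close>. The value is the trace of the operator and
  equals half the geometric series in \<rho>.\<close>

lemma has_integral_m_kernel_diag:
  assumes \<rho>: "\<bar>\<rho>\<bar> < 1"
  shows "has_bochner_integral half_gaussian (\<lambda>x. m_kernel \<rho> x x) (1 / (2 * (1 - \<rho>)))"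
proof -
  have pos: "1 - \<rho> > 0" "1 + \<rho> > 0" using \<rho> by auto
  have fac: "1 - \<rho>\<^sup>2 = (1 - \<rho>) * (1 + \<rho>)" by (simp add: power2_eq_square algebra_simps)
  define c where "c = \<rho> / (1 + \<rho>)"
  have c: "c < 1 / 2" and c2: "1 - 2 * c = (1 - \<rho>) / (1 + \<rho>)"
    using pos by (simp_all add: c_def field_simps)
  have ker: "m_kernel \<rho> x x = 1 / sqrt (1 - \<rho>\<^sup>2) * exp (c * x\<^sup>2)" for x
  proof -
    have "- ((\<rho>\<^sup>2 * x\<^sup>2 + \<rho>\<^sup>2 * x\<^sup>2 - 2 * \<rho> * x * x) / (2 * (1 - \<rho>\<^sup>2))) =
        (2 * (1 - \<rho>)) * (\<rho> * x\<^sup>2) / ((2 * (1 - \<rho>)) * (1 + \<rho>))"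
      unfolding fac minus_divide_left by (simp add: power2_eq_square algebra_simps)
    also have "\<dots> = c * x\<^sup>2"
      using pos by (simp only: mult_divide_mult_cancel_left_if) (simp add: c_def)
    finally show ?thesis by (simp add: m_kernel_def)
  qed
  have val: "1 / sqrt (1 - \<rho>\<^sup>2) * (1 / (2 * sqrt (1 - 2 * c))) = 1 / (2 * (1 - \<rho>))"
  proof -
    have "sqrt (1 - \<rho>\<^sup>2) * sqrt (1 - 2 * c) = sqrt ((1 - \<rho>)\<^sup>2)"
      unfolding c2 fac real_sqrt_mult[symmetric] using pos by (simp add: power2_eq_square)
    also have "\<dots> = 1 - \<rho>" using pos by simp
    finally show ?thesis by (simp add: mult_ac)
  qed
  show ?thesis
    unfolding ker val[symmetric]
    by (rule has_bochner_integral_mult_right) (rule has_integral_half_gaussian_exp[OF c])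
qed

text \<open>At \<rho> = 1/2 all terms of the diagonal Mehler series are nonnegative, so each is
  dominated by the integrable sum. Any parameter strictly between 0 and 1 would serve.\<close>

lemma hermite_fun_L2: "hermite_fun n \<in> L2 half_gaussian"
  unfolding L2_def
proof (intro CollectI conjI)
  have "integrable half_gaussian (\<lambda>x. (1 / 2) ^ n * (hermite_fun n x)\<^sup>2)"
  proof (rule Bochner_Integration.integrable_bound)
    show "integrable half_gaussian (\<lambda>x. m_kernel (1 / 2) x x)"
      using has_integral_m_kernel_diag[of "1 / 2"] by (auto simp: has_bochner_integral_iff)
    have "(1 / 2) ^ n * (hermite_fun n x)\<^sup>2 \<le> m_kernel (1 / 2) x x" for x
    proof -
      have s: "(\<lambda>n. (1 / 2) ^ n * (hermite_fun n x)\<^sup>2) sums m_kernel (1 / 2) x x"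
        using mehler[of "1 / 2" x x] by (simp add: power2_eq_square mult.assoc)
      show ?thesis
        using sum_le_suminf[OF sums_summable[OF s], of "{n}"] sums_unique[OF s] by simp
    qed
    then show "AE x in half_gaussian. norm ((1 / 2) ^ n * (hermite_fun n x)\<^sup>2) \<le> norm (m_kernel (1 / 2) x x)"
      by (intro AE_I2) (smt (verit) norm_ge_zero real_norm_def zero_le_power2 mult_nonneg_nonneg zero_le_power divide_nonneg_nonneg)
  qed measurable
  then show "integrable half_gaussian (\<lambda>x. (hermite_fun n x)\<^sup>2)" by simp
qed measurable

text \<open>The diagonal Mehler series is integrated termwise. Replacing \<rho> by its absolute
  value makes all terms nonnegative, and the trace bounds their partial sums.\<close>

lemma hermite_fun_square_sums:
  assumes \<rho>: "\<bar>\<rho>\<bar> < 1"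
  shows "(\<lambda>n. \<rho> ^ n * (LINT x|half_gaussian. (hermite_fun n x)\<^sup>2)) sums (1 / (2 * (1 - \<rho>)))"
proof -
  let ?I = "\<lambda>n. LINT x|half_gaussian. (hermite_fun n x)\<^sup>2"
  have s: "(\<lambda>n. r ^ n * (hermite_fun n x)\<^sup>2) sums m_kernel r x x" if "\<bar>r\<bar> < 1" for r x
    using mehler[OF that, of x x] by (simp add: power2_eq_square mult.assoc)
  have int: "integrable half_gaussian (\<lambda>x. r ^ n * (hermite_fun n x)\<^sup>2)" for r n
    by (intro integrable_mult_right L2_integrable_square hermite_fun_L2)
  define r where "r = \<bar>\<rho>\<bar>"
  have r: "\<bar>r\<bar> < 1" "r \<ge> 0" using \<rho> by (auto simp: r_def)
  have abs: "norm (\<rho> ^ n * (hermite_fun n x)\<^sup>2) = r ^ n * (hermite_fun n x)\<^sup>2" for n x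
    by (simp add: abs_mult power_abs r_def)
  have mint: "integrable half_gaussian (\<lambda>x. m_kernel r x x)"
    using has_integral_m_kernel_diag[OF r(1)] by (auto simp: has_bochner_integral_iff)
  have "(\<lambda>n. LINT x|half_gaussian. \<rho> ^ n * (hermite_fun n x)\<^sup>2) sums
      (LINT x|half_gaussian. (\<Sum>n. \<rho> ^ n * (hermite_fun n x)\<^sup>2))"
  proof (rule sums_integral[OF int])
    show "AE x in half_gaussian. summable (\<lambda>n. norm (\<rho> ^ n * (hermite_fun n x)\<^sup>2))"
      unfolding abs using s[OF r(1)] by (intro AE_I2) (simp add: sums_iff)
    show "summable (\<lambda>n. LINT x|half_gaussian. norm (\<rho> ^ n * (hermite_fun n x)\<^sup>2))"
      unfolding abs
    proof (rule summableI_nonneg_bounded)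
      show "0 \<le> (LINT x|half_gaussian. r ^ n * (hermite_fun n x)\<^sup>2)" for n
        using r by (intro integral_nonneg_AE AE_I2) simp
      fix n
      have "(\<Sum>i<n. LINT x|half_gaussian. r ^ i * (hermite_fun i x)\<^sup>2) =
          (LINT x|half_gaussian. (\<Sum>i<n. r ^ i * (hermite_fun i x)\<^sup>2))"
        by (rule Bochner_Integration.integral_sum[symmetric]) (rule int)
      also have "\<dots> \<le> (LINT x|half_gaussian. m_kernel r x x)"
      proof (rule integral_mono)
        show "integrable half_gaussian (\<lambda>x. \<Sum>i<n. r ^ i * (hermite_fun i x)\<^sup>2)"
          by (rule Bochner_Integration.integrable_sum) (rule int)
        show "(\<Sum>i<n. r ^ i * (hermite_fun i x)\<^sup>2) \<le> m_kernel r x x" for x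
          unfolding sums_unique[OF s[OF r(1)]] using r
          by (intro sum_le_suminf sums_summable[OF s[OF r(1)]]) auto
      qed (rule mint)
      finally show "(\<Sum>i<n. LINT x|half_gaussian. r ^ i * (hermite_fun i x)\<^sup>2) \<le> (LINT x|half_gaussian. m_kernel r x x)" .
    qed
  qed
  also have "(\<lambda>x. \<Sum>n. \<rho> ^ n * (hermite_fun n x)\<^sup>2) = (\<lambda>x. m_kernel \<rho> x x)"
    using sums_unique[OF s[OF \<rho>]] by simp
  also have "(LINT x|half_gaussian. m_kernel \<rho> x x) = 1 / (2 * (1 - \<rho>))"
    using has_integral_m_kernel_diag[OF \<rho>] by (rule has_bochner_integral_integral_eq)
  finally show ?thesis by simp
qed

text \<open>Comparing coefficients in \<open>hermite_fun_square_sums\<close> with half the geometric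
  series yields all the norms at once, without integration by parts.\<close>

lemma integral_hermite_fun_square: "(LINT x|half_gaussian. (hermite_fun n x)\<^sup>2) = 1 / 2"
proof -
  define a where "a n = (LINT x|half_gaussian. (hermite_fun n x)\<^sup>2) - 1 / 2" for n
  have s: "(\<lambda>n. a n * (x - 0) ^ n) sums 0" if "norm (x - 0) < 1" for x :: real
  proof -
    have x: "\<bar>x\<bar> < 1" using that by simp
    have "(\<lambda>n. x ^ n * (LINT x|half_gaussian. (hermite_fun n x)\<^sup>2) - 1 / 2 * x ^ n) sums
        (1 / (2 * (1 - x)) - 1 / 2 * (1 / (1 - x)))"
      using x by (intro sums_diff hermite_fun_square_sums sums_mult geometric_sums) auto
    then show ?thesis by (simp add: a_def algebra_simps)
  qed
  have "a n = 0"
  proof (cases "n = 0")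
    case True
    have "(\<lambda>n. a n * 0 ^ n) sums 0" using s[of 0] by simp
    then show ?thesis using True by (simp only: powser_sums_zero_iff)
  next
    case False
    show ?thesis
    proof (rule ccontr)
      assume "a n \<noteq> 0"
      \<comment> \<open>A power series that vanishes at its centre and has a nonzero coefficient of
        positive index is nonzero on some punctured disc, whereas here the sum is identically
        0.\<close>
      then obtain s where "0 < s" "\<And>z::real. z \<in> cball 0 s - {0} \<Longrightarrow> (\<lambda>_. 0::real) z \<noteq> 0"
        using powser_0_nonzero[of 1 0 a "\<lambda>_. 0" n] s False by auto
      from this(2)[of s] this(1) show False by simp
    qed
  qed
  then show ?thesis by (simp add: a_def)
qed

section \<open>Identification of \<open>M_op\<close> with the abstract operator\<close>

definition hermite_vec :: "nat \<Rightarrow> hilb" where "hermite_vec n = abs_hilb (hermite_fun n)"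

interpretation hermite: rank_one_series hermite_vec
proof
  show "inner (hermite_vec n) (hermite_vec n) = 1 / 2" for n
    using integral_hermite_fun_square[of n]
    by (simp add: hermite_vec_def inner_abs_hilb hermite_fun_L2 power2_eq_square)
qed

text \<open>Mehler's formula is inserted under the integral, and sum and integral are exchanged.
  This works at each \<open>x\<close> where the series of
  \<open>\<bar>\<rho> ^ n * hermite_fun n x\<bar>\<close> converges, hence almost everywhere because
  the norms in \<open>hilb\<close> are summable.\<close>

lemma M_op_AE_sums:
  assumes \<rho>: "\<bar>\<rho>\<bar> < 1" and f: "f \<in> L2 half_gaussian"
  shows "AE x in half_gaussian.
    (\<lambda>n. (\<rho> ^ n * inner (abs_hilb f) (hermite_vec n)) * hermite_fun n x) sums M_op \<rho> f x"
proof -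
  define r where "r = \<bar>\<rho>\<bar>"
  have r: "\<bar>r\<bar> < 1" "r \<ge> 0" using \<rho> by (auto simp: r_def)
  have "AE x in half_gaussian. summable (\<lambda>n. \<bar>r ^ n * hermite_fun n x\<bar>)"
  proof (rule AE_summable_hilb)
    show "(\<lambda>x. r ^ n * hermite_fun n x) \<in> L2 half_gaussian" for n
      by (intro L2_scale hermite_fun_L2)
    show "summable (\<lambda>n. norm (abs_hilb (\<lambda>x. r ^ n * hermite_fun n x)))"
    proof (rule summable_comparison_test')
      show "summable (\<lambda>n. r ^ n)" using r by (intro summable_geometric) auto
      show "norm (norm (abs_hilb (\<lambda>x. r ^ n * hermite_fun n x))) \<le> r ^ n" for n
        using r mult_left_mono[OF hermite.norm_h_le_1[of n], of "r ^ n"]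
        by (simp add: scaleR_abs_hilb[symmetric] hermite_fun_L2 hermite_vec_def)
    qed
  qed
  then show ?thesis
  proof eventually_elim
    fix x assume sx: "summable (\<lambda>n. \<bar>r ^ n * hermite_fun n x\<bar>)"
    define F where "F n y = (\<rho> ^ n * hermite_fun n x) * (f y * hermite_fun n y)" for n y
    have diag: "summable (\<lambda>n. r ^ n * (hermite_fun n z)\<^sup>2)" for z
      using sums_summable[OF mehler[OF r(1), of z z]] by (simp add: power2_eq_square mult.assoc)
    \<comment> \<open>The product of two values is dominated by the sum of their squares, so the
      diagonal Mehler series at \<open>x\<close> and at \<open>y\<close> provide the
      majorant.\<close>
    have abs_sum: "summable (\<lambda>n. norm (F n y))" for y
    proof (rule summable_comparison_test')
      show "summable (\<lambda>n. \<bar>f y\<bar> * (r ^ n * (hermite_fun n x)\<^sup>2 + r ^ n * (hermite_fun n y)\<^sup>2))"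
        by (intro summable_mult summable_add diag)
      fix n
      have "\<bar>hermite_fun n x\<bar> * \<bar>hermite_fun n y\<bar> \<le> (hermite_fun n x)\<^sup>2 + (hermite_fun n y)\<^sup>2"
      proof -
        have "2 * (\<bar>a\<bar> * \<bar>b\<bar>) \<le> a\<^sup>2 + b\<^sup>2" "0 \<le> \<bar>a\<bar> * \<bar>b\<bar>" for a b :: real
          using sum_squares_bound[of "\<bar>a\<bar>" "\<bar>b\<bar>"] by (simp_all add: mult.assoc)
        from this[of "hermite_fun n x" "hermite_fun n y"] show ?thesis by linarith
      qed
      then have "(\<bar>f y\<bar> * r ^ n) * (\<bar>hermite_fun n x\<bar> * \<bar>hermite_fun n y\<bar>) \<le>
          (\<bar>f y\<bar> * r ^ n) * ((hermite_fun n x)\<^sup>2 + (hermite_fun n y)\<^sup>2)"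
        using r by (intro mult_left_mono) auto
      then show "norm (norm (F n y)) \<le> \<bar>f y\<bar> * (r ^ n * (hermite_fun n x)\<^sup>2 + r ^ n * (hermite_fun n y)\<^sup>2)"
        by (simp add: F_def abs_mult power_abs r_def algebra_simps)
    qed
    have Fsum: "(\<Sum>n. F n y) = f y * m_kernel \<rho> x y" for y
    proof -
      have "(\<lambda>n. f y * (\<rho> ^ n * hermite_fun n x * hermite_fun n y)) sums (f y * m_kernel \<rho> x y)"
        by (rule sums_mult[OF mehler[OF \<rho>]])
      then show ?thesis by (simp add: F_def sums_iff mult_ac)
    qed
    have "(\<lambda>n. integral\<^sup>L half_gaussian (F n)) sums (LINT y|half_gaussian. (\<Sum>n. F n y))"
    proof (rule sums_integral)
      show "integrable half_gaussian (F n)" for n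
        unfolding F_def[abs_def] by (intro integrable_mult_right L2_integrable_mult f hermite_fun_L2)
      show "AE y in half_gaussian. summable (\<lambda>n. norm (F n y))"
        by (intro AE_I2 abs_sum)
      show "summable (\<lambda>n. LINT y|half_gaussian. norm (F n y))"
      proof (rule summable_comparison_test')
        show "summable (\<lambda>n. \<bar>r ^ n * hermite_fun n x\<bar> * norm (abs_hilb f))"
          by (intro summable_mult2 sx)
        fix n
        have "(LINT y|half_gaussian. norm (F n y)) =
            \<bar>r ^ n * hermite_fun n x\<bar> * (LINT y|half_gaussian. \<bar>f y\<bar> * \<bar>hermite_fun n y\<bar>)"
          by (simp add: F_def abs_mult power_abs r_def mult.assoc)
        \<comment> \<open>Cauchy-Schwarz is applied to the absolute values, whose norms agree with
          those of \<open>f\<close> and \<open>hermite_fun n\<close>.\<close>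
        also have "(LINT y|half_gaussian. \<bar>f y\<bar> * \<bar>hermite_fun n y\<bar>) =
            inner (abs_hilb (\<lambda>y. \<bar>f y\<bar>)) (abs_hilb (\<lambda>y. \<bar>hermite_fun n y\<bar>))"
          by (simp add: inner_abs_hilb L2_abs f hermite_fun_L2)
        also have "\<dots> \<le> norm (abs_hilb f) * norm (hermite_vec n)"
          using norm_cauchy_schwarz[of "abs_hilb (\<lambda>y. \<bar>f y\<bar>)" "abs_hilb (\<lambda>y. \<bar>hermite_fun n y\<bar>)"]
          by (simp add: norm_abs_hilb_abs f hermite_fun_L2 hermite_vec_def)
        also have "\<dots> \<le> norm (abs_hilb f) * 1"
          by (intro mult_left_mono hermite.norm_h_le_1 norm_ge_zero)
        finally have "(LINT y|half_gaussian. norm (F n y)) \<le> \<bar>r ^ n * hermite_fun n x\<bar> * norm (abs_hilb f)"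
          by (simp add: mult_left_mono)
        then show "norm (LINT y|half_gaussian. norm (F n y)) \<le> \<bar>r ^ n * hermite_fun n x\<bar> * norm (abs_hilb f)"
          by (simp add: integral_nonneg_AE)
      qed
    qed
    moreover have "integral\<^sup>L half_gaussian (F n) = (\<rho> ^ n * inner (abs_hilb f) (hermite_vec n)) * hermite_fun n x" for n
      by (simp add: F_def[abs_def] hermite_vec_def inner_abs_hilb f hermite_fun_L2)
    ultimately show "(\<lambda>n. (\<rho> ^ n * inner (abs_hilb f) (hermite_vec n)) * hermite_fun n x) sums M_op \<rho> f x"
      by (simp add: Fsum M_op_def)
  qed
qed

text \<open>The series for \<open>M_op\<close> converges almost everywhere, the one defining
  \<open>Mreal\<close> in norm. By \<open>abs_hilb_sums\<close> the two sums represent the same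
  class.\<close>

lemma M_op_eigen_iff:
  assumes \<rho>: "\<bar>\<rho>\<bar> < 1" and f: "f \<in> L2 half_gaussian"
  shows "(AE x in half_gaussian. M_op \<rho> f x = l * f x) \<longleftrightarrow>
    hermite.Mreal \<rho> (abs_hilb f) = l *\<^sub>R abs_hilb f"
proof -
  define g where "g n x = (\<rho> ^ n * inner (abs_hilb f) (hermite_vec n)) * hermite_fun n x" for n x
  have g: "g n \<in> L2 half_gaussian" for n
    unfolding g_def[abs_def] by (intro L2_scale hermite_fun_L2)
  have abs_g: "abs_hilb (g n) = (\<rho> ^ n * inner (abs_hilb f) (hermite_vec n)) *\<^sub>R hermite_vec n" for n
    unfolding g_def[abs_def] by (simp add: scaleR_abs_hilb[symmetric] hermite_fun_L2 hermite_vec_def)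
  have sum: "summable (\<lambda>n. norm (abs_hilb (g n)))"
    using hermite.summable_norm_term[of "of_real \<rho>" "(abs_hilb f, 0)"] \<rho>
    by (simp add: abs_g norm_cscale norm_mult norm_power abs_mult power_abs)
  have "abs_hilb (\<lambda>x. \<Sum>n. g n x) = hermite.Mreal \<rho> (abs_hilb f)"
    using abs_hilb_sums[OF g sum] by (simp add: hermite.Mreal_def abs_g sums_iff)
  then have "hermite.Mreal \<rho> (abs_hilb f) = l *\<^sub>R abs_hilb f \<longleftrightarrow>
      (AE x in half_gaussian. (\<Sum>n. g n x) = l * f x)"
    using abs_hilb_eq_iff[OF L2_suminf[OF g sum] L2_scale[OF f, of l]] by (simp add: scaleR_abs_hilb f)
  moreover have "AE x in half_gaussian. M_op \<rho> f x = (\<Sum>n. g n x)"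
    using M_op_AE_sums[OF \<rho> f] by eventually_elim (simp add: g_def sums_iff)
  then have "(AE x in half_gaussian. M_op \<rho> f x = l * f x) \<longleftrightarrow> (AE x in half_gaussian. (\<Sum>n. g n x) = l * f x)"
    by (auto elim: AE_mp)
  ultimately show ?thesis by blast
qed

lemma is_L2_eigenvalue_M_op_iff:
  assumes \<rho>: "\<bar>\<rho>\<bar> < 1"
  shows "is_L2_eigenvalue half_gaussian (M_op \<rho>) l \<longleftrightarrow> (\<exists>F. F \<noteq> 0 \<and> hermite.Mreal \<rho> F = l *\<^sub>R F)"
proof
  assume "is_L2_eigenvalue half_gaussian (M_op \<rho>) l"
  then obtain f where f: "f \<in> L2 half_gaussian" "\<not> (AE x in half_gaussian. f x = 0)"
    "AE x in half_gaussian. M_op \<rho> f x = l * f x"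
    by (auto simp: is_L2_eigenvalue_def)
  then show "\<exists>F. F \<noteq> 0 \<and> hermite.Mreal \<rho> F = l *\<^sub>R F"
    using M_op_eigen_iff[OF \<rho> f(1)] abs_hilb_eq_iff[OF f(1) L2_zero]
    by (intro exI[of _ "abs_hilb f"]) (auto simp: zero_hilb_def)
next
  assume "\<exists>F. F \<noteq> 0 \<and> hermite.Mreal \<rho> F = l *\<^sub>R F"
  then obtain F where F: "F \<noteq> 0" "hermite.Mreal \<rho> F = l *\<^sub>R F" by blast
  show "is_L2_eigenvalue half_gaussian (M_op \<rho>) l"
    unfolding is_L2_eigenvalue_def
    using M_op_eigen_iff[OF \<rho> L2_rep_hilb[of F], of l] F abs_hilb_eq_iff[OF L2_rep_hilb[of F] L2_zero]
    by (intro bexI[of _ "rep_hilb F"] L2_rep_hilb) (auto simp: zero_hilb_def)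
qed

theorem theorem2:
  shows "\<exists>(r\<^sub>0::real) (K::nat \<Rightarrow> real). 1 / 3 \<le> r\<^sub>0 \<and> r\<^sub>0 \<le> 1 \<and>
    (\<forall>\<rho>\<in>{-r\<^sub>0<..<r\<^sub>0}. (\<lambda>n. K n * \<rho> ^ n) sums top_eigenvalue \<rho>)"
proof -
  obtain K where K: "\<And>t. \<bar>t\<bar> < 1 / 3 \<Longrightarrow> \<exists>l. (\<lambda>n. K n * t ^ n) sums l \<and>
      (\<exists>f. f \<noteq> 0 \<and> hermite.Mreal t f = l *\<^sub>R f) \<and>
      (\<forall>l' g. g \<noteq> 0 \<longrightarrow> hermite.Mreal t g = l' *\<^sub>R g \<longrightarrow> l' \<le> l)"
    using hermite.top_eigenvalue_power_series by blast
  have "(\<lambda>n. K n * \<rho> ^ n) sums top_eigenvalue \<rho>" if "\<rho> \<in> {- (1 / 3)<..<1 / 3}" for \<rho>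
  proof -
    have \<rho>: "\<bar>\<rho>\<bar> < 1 / 3" using that by auto
    then have \<rho>1: "\<bar>\<rho>\<bar> < 1" by simp
    obtain l where l: "(\<lambda>n. K n * \<rho> ^ n) sums l" "\<exists>f. f \<noteq> 0 \<and> hermite.Mreal \<rho> f = l *\<^sub>R f"
      "\<And>l' g. g \<noteq> 0 \<Longrightarrow> hermite.Mreal \<rho> g = l' *\<^sub>R g \<Longrightarrow> l' \<le> l"
      using K[OF \<rho>] by blast
    \<comment> \<open>\<open>l\<close> is an eigenvalue and bounds all others, so
      \<open>GREATEST\<close> denotes it.\<close>
    have "top_eigenvalue \<rho> = l"
      unfolding top_eigenvalue_def is_L2_eigenvalue_M_op_iff[OF \<rho>1]
      using l(2,3) by (intro Greatest_equality) auto
    then show ?thesis using l(1) by simp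
  qed
  then show ?thesis
    by (intro exI[of _ "1 / 3"] exI[of _ K]) auto
qed

end
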